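(* Let $A,B,C$ be finite sets, $\theta=\{1,\dots,T\}$, $\mathcal{S}=\{1,\dots,S\}$, let $W_t:A\to\mathcal{P}(B)$, $t\in\theta$, and $V_s:A\to\mathcal{P}(C)$, $s\in\mathcal{S}$, be channels, and let $\mathfrak{W}=\{(W_t,V_s):t\in\theta,s\in\mathcal{S}\}$. Assume that $V_s$ is a degraded version of $W_t$ for every $s\in\mathcal{S}$ and $t\in\theta$. Then the secrecy capacity of the compound wiretap channel $\mathfrak{W}$ in the case where only the channel state $t$ to the legitimate receiver is known at the transmitter is $$C_{S,CSI_t}(\mathfrak{W})=\min_{t\in\theta}\max_{p\in\mathcal{P}(A)}\Big(I(p,W_t)-\max_{s\in\mathcal{S}}I(p,V_s)\Big).$$
   Context: $\mathcal{P}(B)$ is the set of probability distributions on the finite set $B$; a channel $W:A\to\mathcal{P}(B)$ is a stochastic matrix; $W^{\otimes n}$ is its $n$-th memoryless extension. $I(p,W)$ is the mutual information between input and output of channel $W$ when the input has distribution $p$. Logarithms are to base 2. $W_t$ is the channel to the legitimate receiver, $V_s$ the channel to the eavesdropper. $V_s$ is a degraded version of $W_t$ if there is a stochastic matrix $D_{(t,s)}:B\to\mathcal{P}(C)$ with $V_s(z|x)=\sum_{y\in B}W_t(y|x)D_{(t,s)}(z|y)$ for all $x\in A$, $z\in C$. Code with $CSI_t$ (the transmitter knows $t$ but not $s$; the legitimate receiver knows neither): an $(n,J_n)$ code consists of stochastic encoders $E_t:\mathcal{J}_n\to\mathcal{P}(A^n)$, $t\in\theta$, with $\mathcal{J}_n=\{1,\dots,J_n\}$,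 and mutually disjoint decoding sets $\{D_j\subset B^n:j\in\mathcal{J}_n\}$ not depending on $t$ or $s$. A number $R\ge0$ is an achievable secrecy rate with $CSI_t$ if there is a sequence of such codes with $$\lim_{n\to\infty}\max_{t\in\theta}\max_{j\in\mathcal{J}_n}\sum_{x^n\in A^n}E_t(x^n|j)W_t^{\otimes n}(D_j^c|x^n)=0,\quad \liminf_{n\to\infty}\tfrac1n\log J_n\ge R,\quad \lim_{n\to\infty}\max_{(t,s)\in\theta\times\mathcal{S}}I(J;Z_{t,s}^n)=0,$$ where $J$ is uniform on $\mathcal{J}_n$ and $\Pr(J=j,Z_{t,s}^n=z^n)=\frac1{J_n}\sum_{x^n}E_t(x^n|j)V_s^{\otimes n}(z^n|x^n)$. $C_{S,CSI_t}(\mathfrak{W})$ is the largest (supremum) such $R$. *)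

theory Defs
  imports "HOL-Probability.Probability"
begin

text \<open>
  A finite alphabet is a type of class \<open>finite\<close>, a probability distribution on it is a
  \<open>pmf\<close>, and a channel is a function \<open>'a \<Rightarrow> 'b pmf\<close>. Words of length \<open>n\<close> are lists.
\<close>

definition words :: "nat \<Rightarrow> 'a list set" where
  "words n = {xs. length xs = n}"

primrec memoryless_ext :: "('a \<Rightarrow> 'b pmf) \<Rightarrow> 'a list \<Rightarrow> 'b list pmf" where
  "memoryless_ext W [] = return_pmf []"
| "memoryless_ext W (x # xs) =
     bind_pmf (W x) (\<lambda>y. map_pmf (\<lambda>ys. y # ys) (memoryless_ext W xs))"

lemma pmf_map_Cons:
  "pmf (map_pmf (\<lambda>ys. y # ys) p) zs = (case zs of [] \<Rightarrow> 0 | z # zs' \<Rightarrow> if z = y then pmf p zs' else 0)"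
proof (cases zs)
  case Nil
  then show ?thesis by (auto simp: pmf_eq_0_set_pmf)
next
  case (Cons z zs')
  show ?thesis
  proof (cases "z = y")
    case True
    then show ?thesis using Cons by (simp add: pmf_map_inj' inj_def)
  next
    case False
    then show ?thesis using Cons by (auto simp: pmf_eq_0_set_pmf)
  qed
qed

lemma pmf_memoryless_ext:
  fixes W :: "'a \<Rightarrow> 'b::finite pmf"
  shows "pmf (memoryless_ext W xs) ys =
    (if length ys = length xs then \<Prod>i<length xs. pmf (W (xs ! i)) (ys ! i) else 0)"
proof (induction xs arbitrary: ys)
  case Nil
  then show ?case by (auto simp: pmf_return)
next
  case (Cons x xs)
  show ?case
  proof (cases ys)
    case Nil
    then show ?thesis by (simp add: pmf_bind pmf_map_Cons)
  next
    case (Cons y zs)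
    have "pmf (memoryless_ext W (x # xs)) ys =
        (\<Sum>y'\<in>UNIV. pmf (W x) y' * (if y = y' then pmf (memoryless_ext W xs) zs else 0))"
      by (simp add: pmf_bind pmf_map_Cons Cons integral_measure_pmf_real[where A = UNIV] mult.commute)
    also have "\<dots> = pmf (W x) y * pmf (memoryless_ext W xs) zs"
      by (simp add: if_distrib cong: if_cong)
    finally show ?thesis
      by (simp add: Cons Cons.IH prod.lessThan_Suc_shift del: prod.lessThan_Suc memoryless_ext.simps)
  qed
qed

definition degraded :: "('a \<Rightarrow> 'b::finite pmf) \<Rightarrow> ('a \<Rightarrow> 'c pmf) \<Rightarrow> bool" where
  "degraded W V \<longleftrightarrow>
     (\<exists>D :: 'b \<Rightarrow> 'c pmf. \<forall>x z. pmf (V x) z = (\<Sum>y\<in>UNIV. pmf (W x) y * pmf (D y) z))"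

definition joint_pmf :: "'a pmf \<Rightarrow> ('a \<Rightarrow> 'b pmf) \<Rightarrow> ('a \<times> 'b) pmf" where
  "joint_pmf p W = bind_pmf p (\<lambda>x. map_pmf (Pair x) (W x))"

lemma pmf_joint: "pmf (joint_pmf p W) (x, y) = pmf p x * pmf (W x) y"
proof -
  have "pmf (map_pmf (Pair x') (W x')) (x, y) = (if x' = x then pmf (W x) y else 0)" for x'
  proof (cases "x' = x")
    case True
    then show ?thesis by (simp add: pmf_map_inj' inj_def)
  next
    case False
    then show ?thesis by (auto simp: pmf_eq_0_set_pmf)
  qed
  then have "pmf (joint_pmf p W) (x, y)
      = measure_pmf.expectation p (\<lambda>x'. if x' = x then pmf (W x) y else 0)"
    by (simp add: joint_pmf_def pmf_bind)
  also have "\<dots> = measure_pmf.expectation p (\<lambda>x'. indicator {x} x' * pmf (W x) y)"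
    by (intro Bochner_Integration.integral_cong) (auto simp: indicator_def)
  also have "\<dots> = pmf p x * pmf (W x) y"
    by (simp add: measure_pmf_single)
  finally show ?thesis .
qed

text \<open>
  \<open>mutual_info p W\<close> is \<open>I(p, W)\<close> in bits. The types are countable so that the product of the two
  discrete \<sigma>-algebras is again discrete.
\<close>

definition mutual_info :: "'a::countable pmf \<Rightarrow> ('a \<Rightarrow> 'b::countable pmf) \<Rightarrow> real" where
  "mutual_info p W =
     prob_space.mutual_information (measure_pmf (joint_pmf p W)) 2
       (count_space UNIV) (count_space UNIV) fst snd"

text \<open>
  In a code with messages \<open>{1..J}\<close>, \<open>E t j\<close> is the distribution of the codeword sent for message
  \<open>j\<close> when the legitimate receiver's channel is \<open>W t\<close>.
\<close>

definition is_code ::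
  "nat \<Rightarrow> nat \<Rightarrow> nat \<Rightarrow> (nat \<Rightarrow> nat \<Rightarrow> 'a list pmf) \<Rightarrow> (nat \<Rightarrow> 'b list set) \<Rightarrow> bool" where
  "is_code T n J E D \<longleftrightarrow>
     1 \<le> J \<and>
     (\<forall>t\<in>{1..T}. \<forall>j\<in>{1..J}. set_pmf (E t j) \<subseteq> words n) \<and>
     (\<forall>j\<in>{1..J}. D j \<subseteq> words n) \<and>
     disjoint_family_on D {1..J}"

definition max_error ::
  "nat \<Rightarrow> (nat \<Rightarrow> 'a::finite \<Rightarrow> 'b pmf) \<Rightarrow> nat \<Rightarrow> nat \<Rightarrow>
    (nat \<Rightarrow> nat \<Rightarrow> 'a list pmf) \<Rightarrow> (nat \<Rightarrow> 'b list set) \<Rightarrow> real" where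
  "max_error T W n J E D =
     (MAX t\<in>{1..T}. MAX j\<in>{1..J}.
        \<Sum>xs\<in>words n. pmf (E t j) xs *
          measure_pmf.prob (memoryless_ext (W t) xs) (words n - D j))"

text \<open>
  \<open>I(J; Z)\<close> is the mutual information across the channel that composes the encoder with the
  eavesdropper's memoryless channel, with uniform input on the messages.
\<close>

definition max_leakage ::
  "nat \<Rightarrow> nat \<Rightarrow> (nat \<Rightarrow> 'a \<Rightarrow> 'c::finite pmf) \<Rightarrow> nat \<Rightarrow>
    (nat \<Rightarrow> nat \<Rightarrow> 'a list pmf) \<Rightarrow> real" where
  "max_leakage T S V J E =
     (MAX (t, s)\<in>{1..T} \<times> {1..S}.
        mutual_info (pmf_of_set {1..J}) (\<lambda>j. bind_pmf (E t j) (memoryless_ext (V s))))"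

definition achievable_CSI_t ::
  "nat \<Rightarrow> nat \<Rightarrow> (nat \<Rightarrow> 'a::finite \<Rightarrow> 'b::finite pmf) \<Rightarrow> (nat \<Rightarrow> 'a \<Rightarrow> 'c::finite pmf) \<Rightarrow>
    real \<Rightarrow> bool" where
  "achievable_CSI_t T S W V R \<longleftrightarrow>
     0 \<le> R \<and>
     (\<exists>J E D.
        (\<forall>n. is_code T n (J n) (E n) (D n)) \<and>
        (\<lambda>n. max_error T W n (J n) (E n) (D n)) \<longlonglongrightarrow> 0 \<and>
        ereal R \<le> liminf (\<lambda>n. ereal (1 / real n * log 2 (real (J n)))) \<and>
        (\<lambda>n. max_leakage T S V (J n) (E n)) \<longlonglongrightarrow> 0)"

text \<open>
  The supremum is taken in \<open>ereal\<close>, so that finiteness of the capacity is not built into the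
  definition.
\<close>

definition secrecy_capacity_CSI_t ::
  "nat \<Rightarrow> nat \<Rightarrow> (nat \<Rightarrow> 'a::finite \<Rightarrow> 'b::finite pmf) \<Rightarrow> (nat \<Rightarrow> 'a \<Rightarrow> 'c::finite pmf) \<Rightarrow>
    ereal" where
  "secrecy_capacity_CSI_t T S W V = (SUP R\<in>{R. achievable_CSI_t T S W V R}. ereal R)"

end

theory Submission
  imports Defs
begin

text \<open>
  Converse. For a fixed state \<open>t\<close>, let \<open>p\<close> be the average of the letter distributions of the channel
  input; it does not depend on \<open>s\<close>. Comparing the joint law of message, input and outputs with the
  product law induced by \<open>p\<close> shows, since \<open>V s\<close> is degraded, that \<open>(1 - \<epsilon>) log J - 1 - I(J; Z)\<close> is
  at most \<open>n (I(p, W t) - I(p, V s))\<close>, simultaneously for all \<open>s\<close>.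

  Achievability. Draw for each \<open>t\<close> independent codewords indexed by a message and a randomization
  index, with letters distributed according to an optimal \<open>p t\<close>. The decoder looks for a message one
  of whose codewords, for some \<open>t\<close>, has information density above a threshold slightly below
  \<open>n I(p t, W t)\<close>; by a change of measure a wrong codeword passes this test with small probability
  whatever the output word, so the decoder need not know \<open>t\<close>. A number of randomization indices with
  exponent slightly above \<open>max\<^sub>s I(p t, V s)\<close> brings the eavesdropper's output distribution close in
  divergence to the product distribution for every message. Exponential moments of the information
  density make all error terms exponentially small, and the worse half of the messages is discarded.
\<close>

section \<open>Mutual information and divergence\<close>

text \<open>No auxiliary channel appears in the formula because degradedness makes message, input,
  legitimate output and eavesdropper's output a Markov chain, and against fixed product references
  the gap of the two divergences is linear in the letter distribution of the input. The maximum over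
  \<open>s\<close> stands inside the maximum over \<open>p\<close> because one input must serve
  against every eavesdropper; the minimum over \<open>t\<close> stands outside because the encoder
  may adapt its input to \<open>t\<close>. Two features of the definition shape achievability. The
  leakage is not divided by \<open>n\<close> and must itself vanish, so the divergence is bounded
  through moments of a positive order, which decay exponentially, and not merely through convergence
  of the normalized density. The error is maximal over messages and one code has to serve all
  states, so all errors and leakages are added into a single cost before messages are selected;
  finitely many states cost only a constant factor. Only rates strictly below the formula are
  constructed, which is enough for a supremum.\<close>

lemma set_pmf_joint_pmf: "set_pmf (joint_pmf p W) = (SIGMA x:set_pmf p. set_pmf (W x))"
  by (auto simp: joint_pmf_def)

lemma map_fst_joint_pmf: "map_pmf fst (joint_pmf p W) = p"
  by (simp add: joint_pmf_def map_bind_pmf pmf.map_comp o_def bind_return_pmf' flip: map_pmf_def)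

lemma map_snd_joint_pmf: "map_pmf snd (joint_pmf p W) = bind_pmf p W"
  by (simp add: joint_pmf_def map_bind_pmf pmf.map_comp o_def)

lemma distributed_measure_pmf:
  "distributed (measure_pmf M) (count_space UNIV) X (\<lambda>x. ennreal (pmf (map_pmf X M) x))"
proof -
  have "distr (measure_pmf M) (count_space UNIV) X = measure_pmf (map_pmf X M)"
    by (simp add: map_pmf_rep_eq)
  also have "\<dots> = density (count_space UNIV) (\<lambda>x. ennreal (pmf (map_pmf X M) x))"
    by (rule measure_pmf_eq_density)
  finally show ?thesis
    by (simp add: distributed_def)
qed

text \<open>Messages are naturals and outputs are lists, both infinite types, so finite carriers
  \<open>A\<close> and \<open>B\<close> are carried along; they confine the support of the
  integrand, and the integral becomes a sum. The factor \<open>pmf p x\<close> cancels inside the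
  logarithm wherever the outer weight is nonzero.\<close>

lemma mutual_info_eq:
  fixes p :: "'a::countable pmf" and W :: "'a \<Rightarrow> 'b::countable pmf"
  assumes A: "finite A" "set_pmf p \<subseteq> A" and B: "finite B" "\<And>x. x \<in> A \<Longrightarrow> set_pmf (W x) \<subseteq> B"
  shows "mutual_info p W =
    (\<Sum>x\<in>A. \<Sum>y\<in>B. pmf p x * pmf (W x) y * log 2 (pmf (W x) y / pmf (bind_pmf p W) y))"
proof -
  interpret information_space "measure_pmf (joint_pmf p W)" 2
    by (simp add: information_space_def information_space_axioms_def prob_space_measure_pmf)
  have cs: "count_space UNIV \<Otimes>\<^sub>M count_space UNIV = count_space (UNIV :: ('a \<times> 'b) set)"
    by (subst pair_measure_countable) auto
  define f where "f = (\<lambda>z. pmf (joint_pmf p W) z *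
    log 2 (pmf (joint_pmf p W) z / (pmf p (fst z) * pmf (bind_pmf p W) (snd z))))"
  have "mutual_info p W =
      integral\<^sup>L (count_space UNIV \<Otimes>\<^sub>M count_space UNIV) f"
    unfolding mutual_info_def f_def
  proof (rule mutual_information_distr)
    show "distributed (measure_pmf (joint_pmf p W)) (count_space UNIV) fst (\<lambda>x. ennreal (pmf p x))"
      using distributed_measure_pmf[of "joint_pmf p W" fst] by (simp add: map_fst_joint_pmf)
    show "distributed (measure_pmf (joint_pmf p W)) (count_space UNIV) snd
        (\<lambda>x. ennreal (pmf (bind_pmf p W) x))"
      using distributed_measure_pmf[of "joint_pmf p W" snd] by (simp add: map_snd_joint_pmf)
    show "distributed (measure_pmf (joint_pmf p W)) (count_space UNIV \<Otimes>\<^sub>M count_space UNIV)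
        (\<lambda>x. (fst x, snd x)) (\<lambda>x. ennreal (pmf (joint_pmf p W) x))"
      using distributed_measure_pmf[of "joint_pmf p W" "\<lambda>x. x"] by (simp add: cs)
  qed (auto simp: sigma_finite_measure_count_space_countable)
  also have "\<dots> = (\<Sum>z\<in>{z\<in>UNIV. f z \<noteq> 0}. f z)"
  proof -
    have "{z. f z \<noteq> 0} \<subseteq> A \<times> B"
      using A B by (auto simp: f_def pmf_eq_0_set_pmf set_pmf_joint_pmf)
    then have "finite {z. f z \<noteq> 0}"
      using A(1) B(1) by (metis finite_cartesian_product finite_subset)
    then show ?thesis
      unfolding cs by (simp add: lebesgue_integral_count_space_finite_support)
  qed
  also have "\<dots> = (\<Sum>z\<in>A \<times> B. f z)"
    using A B by (intro sum.mono_neutral_left)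
      (auto simp: f_def pmf_eq_0_set_pmf set_pmf_joint_pmf)
  also have "\<dots> = (\<Sum>x\<in>A. \<Sum>y\<in>B. f (x, y))"
    by (simp add: sum.cartesian_product)
  also have "\<dots> = (\<Sum>x\<in>A. \<Sum>y\<in>B. pmf p x * pmf (W x) y * log 2 (pmf (W x) y / pmf (bind_pmf p W) y))"
    by (intro sum.cong refl) (auto simp: f_def pmf_joint)
  finally show ?thesis .
qed

text \<open>This is \<open>ln r \<le> r - 1\<close>, weighted by \<open>P\<close>. Both total masses
  stay in the bound, so that the comparison measure \<open>P * R\<close> may be subnormalized, as it
  is in the converse.\<close>

lemma gibbs:
  fixes P R :: "'i \<Rightarrow> real"
  assumes "\<And>i. i \<in> I \<Longrightarrow> 0 \<le> P i" and "\<And>i. i \<in> I \<Longrightarrow> P i \<noteq> 0 \<Longrightarrow> 0 < R i"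
  shows "(\<Sum>i\<in>I. P i * log 2 (R i)) \<le> ((\<Sum>i\<in>I. P i * R i) - (\<Sum>i\<in>I. P i)) / ln 2"
proof -
  have "(\<Sum>i\<in>I. P i * log 2 (R i)) \<le> (\<Sum>i\<in>I. (P i * R i - P i) / ln 2)"
  proof (rule sum_mono)
    fix i assume i: "i \<in> I"
    show "P i * log 2 (R i) \<le> (P i * R i - P i) / ln 2"
    proof (cases "P i = 0")
      case False
      have "ln (R i) \<le> R i - 1"
        using assms(2)[OF i False] by (rule ln_le_minus_one)
      then have "P i * ln (R i) \<le> P i * (R i - 1)"
        using assms(1)[OF i] by (rule mult_left_mono)
      then show ?thesis
        by (simp add: log_def field_simps)
    qed simp
  qed
  then show ?thesis
    by (simp add: sum_subtractf sum_divide_distrib diff_divide_distrib)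
qed

section \<open>Finite sums and relative entropy\<close>

lemma pmf_bind_finite:
  assumes "finite A" "set_pmf p \<subseteq> A"
  shows "pmf (bind_pmf p W) y = (\<Sum>x\<in>A. pmf p x * pmf (W x) y)"
  unfolding pmf_bind
  by (subst integral_measure_pmf_real[OF assms(1)]) (use assms(2) in \<open>auto simp: mult.commute\<close>)

lemma expectation_finite:
  fixes f :: "'a \<Rightarrow> real"
  assumes "finite A" "set_pmf p \<subseteq> A"
  shows "measure_pmf.expectation p f = (\<Sum>x\<in>A. pmf p x * f x)"
  by (subst integral_measure_pmf_real[OF assms(1)]) (use assms(2) in \<open>auto simp: mult.commute\<close>)

text \<open>Relative entropy in bits over an explicit carrier. A point of zero \<open>Q\<close>-mass
  but positive \<open>P\<close>-mass would contribute a finite default value in place of infinity;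
  hence the support inclusions assumed wherever the usual properties are derived.\<close>

definition divergence :: "'a set \<Rightarrow> 'a pmf \<Rightarrow> 'a pmf \<Rightarrow> real" where
  "divergence A P Q = (\<Sum>a\<in>A. pmf P a * log 2 (pmf P a / pmf Q a))"

lemma divergence_nonneg:
  assumes "finite A" "set_pmf P \<subseteq> A" "set_pmf P \<subseteq> set_pmf Q"
  shows "0 \<le> divergence A P Q"
proof -
  have *: "pmf Q a > 0" if "pmf P a \<noteq> 0" for a
    using that assms(3) by (auto simp: set_pmf_iff pmf_positive)
  have "- divergence A P Q = (\<Sum>a\<in>A. pmf P a * log 2 (pmf Q a / pmf P a))"
    unfolding divergence_def sum_negf[symmetric]
  proof (intro sum.cong refl)
    fix a
    show "- (pmf P a * log 2 (pmf P a / pmf Q a)) = pmf P a * log 2 (pmf Q a / pmf P a)"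
      using *[of a] by (cases "pmf P a = 0") (auto simp: log_divide order_less_le pmf_nonneg algebra_simps)
  qed
  also have "\<dots> \<le> ((\<Sum>a\<in>A. pmf P a * (pmf Q a / pmf P a)) - (\<Sum>a\<in>A. pmf P a)) / ln 2"
    using * by (intro gibbs) (auto simp: order_less_le pmf_nonneg)
  also have "\<dots> \<le> 0"
  proof -
    have "(\<Sum>a\<in>A. pmf P a * (pmf Q a / pmf P a)) \<le> (\<Sum>a\<in>A. pmf Q a)"
      by (intro sum_mono) (auto simp: pmf_nonneg)
    also have "\<dots> \<le> 1"
      using measure_pmf.prob_le_1[of Q A] assms(1) by (simp add: measure_measure_pmf_finite)
    also have "1 = (\<Sum>a\<in>A. pmf P a)"
      using sum_pmf_eq_1[OF assms(1,2)] by simp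
    finally show ?thesis
      by (simp add: divide_nonpos_pos)
  qed
  finally show ?thesis by simp
qed

text \<open>Inserting the true output distribution into the likelihood ratio splits the logarithm;
  the second part no longer depends on the input, so averaging over \<open>p\<close> leaves one
  divergence between output distributions.\<close>

lemma divergence_compensation:
  assumes A: "finite A" "set_pmf p \<subseteq> A" and B: "finite B" "\<And>x. x \<in> A \<Longrightarrow> set_pmf (W x) \<subseteq> B"
    and Q: "\<And>x. x \<in> set_pmf p \<Longrightarrow> set_pmf (W x) \<subseteq> set_pmf Q"
  shows "(\<Sum>x\<in>A. pmf p x * divergence B (W x) Q) =
    mutual_info p W + divergence B (bind_pmf p W) Q"
proof -
  let ?q = "bind_pmf p W"
  have "pmf p x * pmf (W x) y * log 2 (pmf (W x) y / pmf Q y) =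
      pmf p x * pmf (W x) y * log 2 (pmf (W x) y / pmf ?q y) +
      pmf p x * pmf (W x) y * log 2 (pmf ?q y / pmf Q y)" for x y
  proof (cases "pmf p x = 0 \<or> pmf (W x) y = 0")
    case False
    then have s: "x \<in> set_pmf p" "y \<in> set_pmf (W x)"
      by (auto simp: set_pmf_iff)
    then have "y \<in> set_pmf ?q" "y \<in> set_pmf Q"
      using Q by (auto simp: set_bind_pmf)
    then have "pmf (W x) y > 0" "pmf ?q y > 0" "pmf Q y > 0"
      using s by (simp_all add: pmf_positive_iff del: set_bind_pmf)
    then show ?thesis
      by (simp add: log_divide algebra_simps)
  qed auto
  then have "(\<Sum>x\<in>A. pmf p x * divergence B (W x) Q) = mutual_info p W +
      (\<Sum>x\<in>A. \<Sum>y\<in>B. pmf p x * pmf (W x) y * log 2 (pmf ?q y / pmf Q y))"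
    by (subst mutual_info_eq[OF assms(1-4)])
      (simp_all add: divergence_def sum_distrib_left mult.assoc sum.distrib)
  also have "(\<Sum>x\<in>A. \<Sum>y\<in>B. pmf p x * pmf (W x) y * log 2 (pmf ?q y / pmf Q y)) =
      divergence B ?q Q"
    unfolding divergence_def pmf_bind_finite[OF A]
    by (subst sum.swap) (simp add: sum_distrib_right)
  finally show ?thesis .
qed

lemma mutual_info_eq_divergence:
  assumes "finite A" "set_pmf p \<subseteq> A" "finite B" "\<And>x. x \<in> A \<Longrightarrow> set_pmf (W x) \<subseteq> B"
  shows "mutual_info p W = (\<Sum>x\<in>A. pmf p x * divergence B (W x) (bind_pmf p W))"
  by (subst mutual_info_eq[OF assms]) (simp_all add: divergence_def sum_distrib_left mult.assoc)

lemma mutual_info_nonneg: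
  assumes "finite A" "set_pmf p \<subseteq> A" "finite B" "\<And>x. x \<in> A \<Longrightarrow> set_pmf (W x) \<subseteq> B"
  shows "0 \<le> mutual_info p W"
proof (subst mutual_info_eq_divergence[OF assms], assumption, rule sum_nonneg)
  fix x assume x: "x \<in> A"
  show "0 \<le> pmf p x * divergence B (W x) (bind_pmf p W)"
  proof (cases "x \<in> set_pmf p")
    case True
    then show ?thesis
      using assms x by (intro mult_nonneg_nonneg divergence_nonneg) auto
  qed (simp add: set_pmf_iff)
qed

text \<open>The true output distribution minimizes the mean divergence, so any reference
  \<open>Q\<close> gives an upper bound. Leakage is bounded this way, with \<open>Q\<close> a fixed
  target independent of the message.\<close>

lemma mutual_info_le_divergence:
  assumes A: "finite A" "set_pmf p \<subseteq> A" and B: "finite B" "\<And>x. x \<in> A \<Longrightarrow> set_pmf (W x) \<subseteq> B"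
    and Q: "\<And>x. x \<in> set_pmf p \<Longrightarrow> set_pmf (W x) \<subseteq> set_pmf Q"
  shows "mutual_info p W \<le> (\<Sum>x\<in>A. pmf p x * divergence B (W x) Q)"
proof -
  have "0 \<le> divergence B (bind_pmf p W) Q"
    using A B Q by (intro divergence_nonneg) (fastforce simp: set_bind_pmf)+
  then show ?thesis
    using divergence_compensation[OF assms] by simp
qed

section \<open>Words and memoryless extensions\<close>

lemma finite_words [simp]: "finite (words n :: 'a::finite list set)"
  using finite_lists_length_eq[of "UNIV :: 'a set" n] by (simp add: words_def)

lemma words_0: "words 0 = {[]}"
  by (auto simp: words_def)

lemma sum_words_Suc:
  fixes f :: "'a::finite list \<Rightarrow> 'b::comm_monoid_add"
  shows "(\<Sum>xs\<in>words (Suc n). f xs) = (\<Sum>x\<in>UNIV. \<Sum>xs\<in>words n. f (x # xs))"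
proof -
  have "words (Suc n) = (\<lambda>(x, xs). x # xs) ` (UNIV \<times> words n :: ('a \<times> 'a list) set)"
    by (auto simp: words_def length_Suc_conv image_iff)
  then have "(\<Sum>xs\<in>words (Suc n). f xs) = (\<Sum>(x, xs)\<in>UNIV \<times> words n. f (x # xs))"
    by (simp add: sum.reindex inj_on_def case_prod_beta' o_def prod_eq_iff)
  then show ?thesis
    by (simp add: sum.cartesian_product)
qed

lemma set_pmf_memoryless_ext:
  "ys \<in> set_pmf (memoryless_ext W xs) \<longleftrightarrow> list_all2 (\<lambda>x y. y \<in> set_pmf (W x)) xs ys"
  by (induction xs arbitrary: ys) (auto simp: list_all2_Cons1)

lemma set_pmf_memoryless_ext_words:
  assumes "xs \<in> words n"
  shows "set_pmf (memoryless_ext W xs) \<subseteq> words n"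
  using assms by (auto simp: set_pmf_memoryless_ext words_def list_all2_iff)

lemma pmf_memoryless_ext_Cons:
  fixes W :: "'a \<Rightarrow> 'b::finite pmf"
  shows "pmf (memoryless_ext W (x # xs)) (y # ys) = pmf (W x) y * pmf (memoryless_ext W xs) ys"
  by (simp add: pmf_memoryless_ext prod.lessThan_Suc_shift del: prod.lessThan_Suc memoryless_ext.simps)

text \<open>Processing one output letter commutes with drawing the later ones, as they are
  independent. Degradedness of letters thereby passes to words.\<close>

lemma memoryless_ext_compose:
  "bind_pmf (memoryless_ext W xs) (memoryless_ext D) = memoryless_ext (\<lambda>x. bind_pmf (W x) D) xs"
proof (induction xs)
  case (Cons x xs)
  have "bind_pmf (memoryless_ext W (x # xs)) (memoryless_ext D) =
      bind_pmf (W x) (\<lambda>y. bind_pmf (memoryless_ext W xs) (\<lambda>ys. bind_pmf (D y)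
        (\<lambda>z. map_pmf ((#) z) (memoryless_ext D ys))))"
    by (simp add: bind_assoc_pmf bind_map_pmf)
  also have "\<dots> = bind_pmf (W x) (\<lambda>y. bind_pmf (D y) (\<lambda>z. bind_pmf (memoryless_ext W xs)
        (\<lambda>ys. map_pmf ((#) z) (memoryless_ext D ys))))"
    by (intro bind_pmf_cong refl bind_commute_pmf)
  also have "\<dots> = memoryless_ext (\<lambda>x. bind_pmf (W x) D) (x # xs)"
    by (simp add: bind_assoc_pmf Cons.IH[symmetric] map_bind_pmf)
  finally show ?case .
qed (simp add: bind_return_pmf)

text \<open>The product distribution, written as a memoryless channel fed with unit inputs, so that
  the lemmas on \<open>memoryless_ext\<close> apply to it directly.\<close>

definition iid :: "nat \<Rightarrow> 'a pmf \<Rightarrow> 'a list pmf" where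
  "iid n p = memoryless_ext (\<lambda>_. p) (replicate n ())"

lemma pmf_iid_0: "pmf (iid 0 p) [] = 1"
  by (simp add: iid_def)

lemma pmf_iid_Cons: "pmf (iid (Suc n) (p :: 'a::finite pmf)) (x # xs) = pmf p x * pmf (iid n p) xs"
  by (simp add: iid_def pmf_memoryless_ext_Cons del: memoryless_ext.simps)

lemma set_pmf_iid: "set_pmf (iid n p) = {xs \<in> words n. set xs \<subseteq> set_pmf p}"
  by (auto simp: iid_def set_pmf_memoryless_ext words_def list_all2_conv_all_nth
      subset_iff all_set_conv_all_nth) (auto simp: in_set_conv_nth)

lemma bind_iid: "bind_pmf (iid n p) (memoryless_ext W) = iid n (bind_pmf p W)"
  by (simp add: iid_def memoryless_ext_compose)

section \<open>The converse\<close>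

text \<open>One application of Gibbs' inequality gives Fano's inequality, degradedness and
  single-letterization together. The weight \<open>r j y\<close> in the proof plays the role of the posterior of
  the message: it mixes the decision of the decoder with a uniform guess, so that
  \<open>log 2 (J * r j y)\<close> is at least \<open>log 2 J - 1\<close> on \<open>D j\<close> and at least \<open>-1\<close> elsewhere.\<close>

lemma one_shot_converse:
  fixes E :: "nat \<Rightarrow> 'x pmf" and W :: "'x \<Rightarrow> 'y pmf" and K :: "'y \<Rightarrow> 'z::countable pmf"
  assumes J: "1 \<le> J"
    and fin: "finite X" "finite Y" "finite Z"
    and E: "\<And>j. j \<in> {1..J} \<Longrightarrow> set_pmf (E j) \<subseteq> X"
    and W: "\<And>x. x \<in> X \<Longrightarrow> set_pmf (W x) \<subseteq> Y"
    and K: "\<And>y. y \<in> Y \<Longrightarrow> set_pmf (K y) \<subseteq> Z"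
    and Q: "set_pmf Q \<subseteq> Y" "\<And>j x. j \<in> {1..J} \<Longrightarrow> x \<in> set_pmf (E j) \<Longrightarrow> set_pmf (W x) \<subseteq> set_pmf Q"
    and D: "disjoint_family_on D {1..J}"
    and err: "\<And>j. j \<in> {1..J} \<Longrightarrow> (\<Sum>x\<in>X. pmf (E j) x * measure_pmf.prob (W x) (Y - D j)) \<le> \<epsilon>"
  defines "U \<equiv> pmf_of_set {1..J}"
  shows "(1 - \<epsilon>) * log 2 (real J) - 1 - mutual_info U (\<lambda>j. bind_pmf (E j) (\<lambda>x. bind_pmf (W x) K))
    \<le> (\<Sum>x\<in>X. pmf (bind_pmf U E) x * (divergence Y (W x) Q -
          divergence Z (bind_pmf (W x) K) (bind_pmf Q K)))"
proof -
  define V where "V x = bind_pmf (W x) K" for x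
  define PJ where "PJ j = bind_pmf (E j) V" for j
  define PZ where "PZ = bind_pmf U PJ"
  define QZ where "QZ = bind_pmf Q K"
  define r where "r j y = (if y \<in> D j then 1 / 2 else 0) + 1 / (2 * real J)" for j y
  \<comment> \<open>\<open>P\<close> is the joint law along the chain message, input, legitimate
    output, eavesdropper's output. Up to vanishing denominators, \<open>P * R\<close> is the law
    that draws \<open>z\<close> from \<open>PZ\<close>, then \<open>y\<close> from its posterior
    under \<open>Q\<close> and \<open>K\<close>, then \<open>j\<close> with weight
    \<open>r j y\<close>, then \<open>x\<close> from its posterior given \<open>j\<close> and
    \<open>z\<close>.\<close>
  define P where "P j x y z = pmf (E j) x * pmf (W x) y * pmf (K y) z / real J" for j x y z
  define R where "R j x y z = real J * r j y * pmf PZ z * pmf Q y * pmf (V x) z /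
    (pmf (PJ j) z * pmf (W x) y * pmf QZ z)" for j x y z
  let ?S = "\<lambda>f. \<Sum>j\<in>{1..J}. \<Sum>x\<in>X. \<Sum>y\<in>Y. \<Sum>z\<in>Z. P j x y z * f j x y z"

  have Jpos: "real J > 0"
    using J by simp
  have setU: "set_pmf U = {1..J}" and pmfU: "pmf U j = (if j \<in> {1..J} then 1 / real J else 0)" for j
    using J by (auto simp: U_def)
  have V_eq: "pmf (V x) z = (\<Sum>y\<in>Y. pmf (W x) y * pmf (K y) z)" if "x \<in> X" for x z
    unfolding V_def using W[OF that] fin by (intro pmf_bind_finite)
  have PJ_eq: "pmf (PJ j) z = (\<Sum>x\<in>X. pmf (E j) x * pmf (V x) z)" if "j \<in> {1..J}" for j z
    unfolding PJ_def using E[OF that] fin by (intro pmf_bind_finite)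
  have QZ_eq: "pmf QZ z = (\<Sum>y\<in>Y. pmf Q y * pmf (K y) z)" for z
    unfolding QZ_def using Q fin by (intro pmf_bind_finite)
  have UE_eq: "pmf (bind_pmf U E) x = (\<Sum>j\<in>{1..J}. pmf (E j) x / real J)" for x
    by (subst pmf_bind_finite[of "{1..J}"]) (auto simp: setU pmfU)
  have setV: "set_pmf (V x) \<subseteq> Z" if "x \<in> X" for x
    using W[OF that] K by (fastforce simp: V_def)
  have setPJ: "set_pmf (PJ j) \<subseteq> Z" if "j \<in> {1..J}" for j
    using E[OF that] setV by (fastforce simp: PJ_def)
  have setPZ: "set_pmf PZ \<subseteq> Z"
    using setPJ by (fastforce simp: PZ_def setU)
  have sumE: "(\<Sum>x\<in>X. pmf (E j) x) = 1" if "j \<in> {1..J}" for j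
    using E[OF that] fin by (intro sum_pmf_eq_1)
  have sumW: "(\<Sum>y\<in>Y. pmf (W x) y) = 1" if "x \<in> X" for x
    using W[OF that] fin by (intro sum_pmf_eq_1)
  have sumK: "(\<Sum>z\<in>Z. pmf (K y) z) = 1" if "y \<in> Y" for y
    using K[OF that] fin by (intro sum_pmf_eq_1)
  have r_pos: "r j y > 0" for j y
    using Jpos by (simp add: r_def add_nonneg_pos)
  \<comment> \<open>A given \<open>y\<close> lies in at most one \<open>D j\<close>, which
    contributes 1/2; the uniform guess contributes the other half.\<close>
  have r_sum: "(\<Sum>j\<in>{1..J}. r j y) \<le> 1" for y
  proof -
    have "(\<Sum>j\<in>{1..J}. if y \<in> D j then 1 / 2 else 0 :: real) = real (card {j\<in>{1..J}. y \<in> D j}) / 2"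
      by (simp flip: sum.inter_filter)
    moreover have "card {j\<in>{1..J}. y \<in> D j} \<le> 1"
    proof -
      have "i = j" if "i \<in> {1..J}" "j \<in> {1..J}" "y \<in> D i" "y \<in> D j" for i j
        using disjoint_family_onD[OF D that(1,2)] that(3,4) by (cases "i = j") auto
      then have "\<forall>i\<in>{j \<in> {1..J}. y \<in> D j}. \<forall>j\<in>{j \<in> {1..J}. y \<in> D j}. i = j"
        by blast
      then show ?thesis
        unfolding One_nat_def by (subst card_le_Suc0_iff_eq) simp_all
    qed
    ultimately show ?thesis
      using Jpos by (simp add: r_def sum.distrib)
  qed
  have marg_jy: "?S (\<lambda>j x y z. f j y) = (\<Sum>j\<in>{1..J}. \<Sum>x\<in>X. \<Sum>y\<in>Y. pmf (E j) x * pmf (W x) y * f j y / real J)"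
    for f :: "nat \<Rightarrow> 'y \<Rightarrow> real"
  proof (intro sum.cong refl)
    fix j x y assume "y \<in> Y"
    have "(\<Sum>z\<in>Z. P j x y z * f j y) = pmf (E j) x * pmf (W x) y * f j y / real J * (\<Sum>z\<in>Z. pmf (K y) z)"
      unfolding sum_distrib_left by (intro sum.cong refl) (simp add: P_def)
    then show "(\<Sum>z\<in>Z. P j x y z * f j y) = pmf (E j) x * pmf (W x) y * f j y / real J"
      using sumK[OF \<open>y \<in> Y\<close>] by simp
  qed
  have marg_xy: "?S (\<lambda>j x y z. f x y) = (\<Sum>x\<in>X. pmf (bind_pmf U E) x * (\<Sum>y\<in>Y. pmf (W x) y * f x y))"
    for f :: "'x \<Rightarrow> 'y \<Rightarrow> real"
  proof -
    have "?S (\<lambda>j x y z. f x y) = (\<Sum>j\<in>{1..J}. \<Sum>x\<in>X. pmf (E j) x / real J * (\<Sum>y\<in>Y. pmf (W x) y * f x y))"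
    proof (intro sum.cong refl)
      fix j x
      have "(\<Sum>z\<in>Z. P j x y z * f x y) = pmf (E j) x / real J * (pmf (W x) y * f x y)" if "y \<in> Y" for y
      proof -
        have "(\<Sum>z\<in>Z. P j x y z * f x y) = pmf (E j) x * pmf (W x) y * f x y / real J * (\<Sum>z\<in>Z. pmf (K y) z)"
          unfolding sum_distrib_left by (intro sum.cong refl) (simp add: P_def)
        then show ?thesis
          using sumK[OF that] by simp
      qed
      then show "(\<Sum>y\<in>Y. \<Sum>z\<in>Z. P j x y z * f x y) = pmf (E j) x / real J * (\<Sum>y\<in>Y. pmf (W x) y * f x y)"
        unfolding sum_distrib_left by (intro sum.cong refl)
    qed
    then show ?thesis
      unfolding UE_eq sum_distrib_right by (subst (asm) sum.swap)
  qed
  have marg_xz': "(\<Sum>y\<in>Y. \<Sum>z\<in>Z. P j x y z * f z) = pmf (E j) x / real J * (\<Sum>z\<in>Z. pmf (V x) z * f z)"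
    if "x \<in> X" for j x and f :: "'z \<Rightarrow> real"
  proof -
    have "(\<Sum>y\<in>Y. \<Sum>z\<in>Z. P j x y z * f z) = (\<Sum>z\<in>Z. \<Sum>y\<in>Y. P j x y z * f z)"
      by (rule sum.swap)
    also have "\<dots> = (\<Sum>z\<in>Z. pmf (E j) x / real J * (pmf (V x) z * f z))"
      unfolding V_eq[OF that] sum_distrib_left sum_distrib_right
      by (intro sum.cong refl) (simp add: P_def)
    finally show ?thesis
      by (simp add: sum_distrib_left)
  qed
  have marg_xz: "?S (\<lambda>j x y z. f x z) = (\<Sum>x\<in>X. pmf (bind_pmf U E) x * (\<Sum>z\<in>Z. pmf (V x) z * f x z))"
    for f :: "'x \<Rightarrow> 'z \<Rightarrow> real"
  proof -
    have "?S (\<lambda>j x y z. f x z) = (\<Sum>j\<in>{1..J}. \<Sum>x\<in>X. pmf (E j) x / real J * (\<Sum>z\<in>Z. pmf (V x) z * f x z))"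
      by (intro sum.cong refl marg_xz')
    then show ?thesis
      unfolding UE_eq sum_distrib_right by (subst (asm) sum.swap)
  qed
  have marg_jz: "?S (\<lambda>j x y z. f j z) = (\<Sum>j\<in>{1..J}. \<Sum>z\<in>Z. pmf U j * pmf (PJ j) z * f j z)"
    for f :: "nat \<Rightarrow> 'z \<Rightarrow> real"
  proof (rule sum.cong[OF refl])
    fix j assume j: "j \<in> {1..J}"
    have "(\<Sum>x\<in>X. \<Sum>y\<in>Y. \<Sum>z\<in>Z. P j x y z * f j z) =
        (\<Sum>x\<in>X. pmf (E j) x / real J * (\<Sum>z\<in>Z. pmf (V x) z * f j z))"
      by (intro sum.cong refl marg_xz')
    also have "\<dots> = (\<Sum>z\<in>Z. \<Sum>x\<in>X. pmf (E j) x / real J * (pmf (V x) z * f j z))"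
      unfolding sum_distrib_left by (rule sum.swap)
    also have "\<dots> = (\<Sum>z\<in>Z. pmf U j * pmf (PJ j) z * f j z)"
      unfolding PJ_eq[OF j] sum_distrib_left sum_distrib_right pmfU
      using j by (intro sum.cong refl) simp
    finally show "(\<Sum>x\<in>X. \<Sum>y\<in>Y. \<Sum>z\<in>Z. P j x y z * f j z) = \<dots>" .
  qed

  have pos: "pmf (E j) x > 0" "pmf (W x) y > 0" "pmf (K y) z > 0" "pmf (PJ j) z > 0" "pmf PZ z > 0"
      "pmf Q y > 0" "pmf QZ z > 0" "pmf (V x) z > 0"
    if "j \<in> {1..J}" "x \<in> X" "y \<in> Y" "P j x y z \<noteq> 0" for j x y z
  proof -
    have *: "x \<in> set_pmf (E j)" "y \<in> set_pmf (W x)" "z \<in> set_pmf (K y)"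
      using that(4) by (auto simp: P_def set_pmf_iff)
    then have "z \<in> set_pmf (V x)" "y \<in> set_pmf Q"
      using Q(2)[OF that(1)] by (auto simp: V_def)
    moreover from this * have "z \<in> set_pmf (PJ j)" "z \<in> set_pmf QZ"
      by (auto simp: PJ_def QZ_def)
    moreover from this that(1) have "z \<in> set_pmf PZ"
      unfolding PZ_def set_bind_pmf setU by blast
    ultimately show "pmf (E j) x > 0" "pmf (W x) y > 0" "pmf (K y) z > 0" "pmf (PJ j) z > 0"
        "pmf PZ z > 0" "pmf Q y > 0" "pmf QZ z > 0" "pmf (V x) z > 0"
      using * by (simp_all add: pmf_positive)
  qed

  have S_prod: "?S f = (\<Sum>(j, x, y, z)\<in>{1..J} \<times> X \<times> Y \<times> Z. P j x y z * f j x y z)" for f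
    by (simp add: sum.cartesian_product)
  have P_nonneg: "0 \<le> P j x y z" for j x y z
    by (simp add: P_def)
  have total: "?S (\<lambda>j x y z. 1) = 1"
  proof -
    have "?S (\<lambda>j x y z. 1) = (\<Sum>j\<in>{1..J}. \<Sum>x\<in>X. pmf (E j) x / real J * (\<Sum>y\<in>Y. pmf (W x) y))"
      unfolding marg_jy[of "\<lambda>_ _. 1"] by (simp add: sum_distrib_left)
    also have "\<dots> = (\<Sum>j\<in>{1..J}. 1 / real J)"
    proof (intro sum.cong refl)
      fix j assume j: "j \<in> {1..J}"
      show "(\<Sum>x\<in>X. pmf (E j) x / real J * (\<Sum>y\<in>Y. pmf (W x) y)) = 1 / real J"
        using sumE[OF j] by (simp add: sumW flip: sum_divide_distrib)
    qed
    finally show ?thesis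
      using Jpos by simp
  qed
  \<comment> \<open>The mass of the comparison law is summed out backwards, over \<open>x\<close>,
    \<open>j\<close>, \<open>y\<close>, \<open>z\<close> in turn. Inequalities arise because a
    conditional with zero denominator loses its mass and because \<open>r\<close> is only
    subnormalized in \<open>j\<close>.\<close>
  have "?S R \<le> (\<Sum>j\<in>{1..J}. \<Sum>x\<in>X. \<Sum>y\<in>Y. \<Sum>z\<in>Z.
      r j y * pmf PZ z * pmf Q y * pmf (K y) z / (pmf (PJ j) z * pmf QZ z) * (pmf (E j) x * pmf (V x) z))"
  proof (intro sum_mono)
    fix j x y z assume jx: "j \<in> {1..J}" "x \<in> X" "y \<in> Y"
    show "P j x y z * R j x y z \<le>
      r j y * pmf PZ z * pmf Q y * pmf (K y) z / (pmf (PJ j) z * pmf QZ z) * (pmf (E j) x * pmf (V x) z)"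
    proof (cases "P j x y z = 0")
      case True
      then show ?thesis
        using r_pos[of j y] by (simp add: order_less_imp_le)
    next
      case False
      show ?thesis
        using pos[OF jx False] Jpos by (simp add: P_def R_def field_simps)
    qed
  qed
  also have "\<dots> = (\<Sum>j\<in>{1..J}. \<Sum>y\<in>Y. \<Sum>z\<in>Z.
      r j y * pmf PZ z * pmf Q y * pmf (K y) z / (pmf (PJ j) z * pmf QZ z) * pmf (PJ j) z)"
  proof (rule sum.cong[OF refl])
    fix j assume j: "j \<in> {1..J}"
    show "(\<Sum>x\<in>X. \<Sum>y\<in>Y. \<Sum>z\<in>Z. r j y * pmf PZ z * pmf Q y * pmf (K y) z /
          (pmf (PJ j) z * pmf QZ z) * (pmf (E j) x * pmf (V x) z)) =
        (\<Sum>y\<in>Y. \<Sum>z\<in>Z. r j y * pmf PZ z * pmf Q y * pmf (K y) z /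
          (pmf (PJ j) z * pmf QZ z) * pmf (PJ j) z)"
      by (subst sum.swap, intro sum.cong refl, subst sum.swap)
        (simp add: PJ_eq[OF j] sum_distrib_left)
  qed
  also have "\<dots> \<le> (\<Sum>j\<in>{1..J}. \<Sum>y\<in>Y. \<Sum>z\<in>Z. r j y * (pmf PZ z * pmf Q y * pmf (K y) z / pmf QZ z))"
    using r_pos by (intro sum_mono) (auto simp: order_less_imp_le intro!: mult_nonneg_nonneg divide_nonneg_nonneg)
  also have "\<dots> = (\<Sum>y\<in>Y. \<Sum>z\<in>Z. (\<Sum>j\<in>{1..J}. r j y) * (pmf PZ z * pmf Q y * pmf (K y) z / pmf QZ z))"
    by (subst sum.swap, intro sum.cong refl, subst sum.swap) (simp add: sum_distrib_right sum_divide_distrib)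
  also have "\<dots> \<le> (\<Sum>y\<in>Y. \<Sum>z\<in>Z. 1 * (pmf PZ z * pmf Q y * pmf (K y) z / pmf QZ z))"
    by (intro sum_mono mult_right_mono r_sum) auto
  also have "\<dots> = (\<Sum>z\<in>Z. pmf PZ z * pmf QZ z / pmf QZ z)"
    by (subst sum.swap) (simp add: QZ_eq sum_distrib_left sum_divide_distrib mult.assoc)
  also have "\<dots> \<le> (\<Sum>z\<in>Z. pmf PZ z)"
    by (intro sum_mono) auto
  also have "\<dots> = 1"
    using setPZ fin by (intro sum_pmf_eq_1)
  finally have SR: "?S R \<le> 1" .

  have "?S (\<lambda>j x y z. log 2 (R j x y z)) \<le> (?S R - ?S (\<lambda>j x y z. 1)) / ln 2"
    unfolding S_prod case_prod_beta'
  proof (rule order_trans[OF gibbs])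
    show "0 < R (fst i) (fst (snd i)) (fst (snd (snd i))) (snd (snd (snd i)))"
      if "i \<in> {1..J} \<times> X \<times> Y \<times> Z" "P (fst i) (fst (snd i)) (fst (snd (snd i))) (snd (snd (snd i))) \<noteq> 0" for i
      using that pos[of "fst i" "fst (snd i)" "fst (snd (snd i))" "snd (snd (snd i))"] Jpos r_pos
      by (auto simp: R_def)
  qed (simp_all add: P_nonneg)
  also have "\<dots> \<le> 0"
    using SR total by (simp add: divide_nonpos_pos)
  finally have main: "?S (\<lambda>j x y z. log 2 (R j x y z)) \<le> 0" .

  \<comment> \<open>The factors of \<open>R\<close> separate into the decoder's weight, the leakage
    density and the two divergence densities. Each involves only two of the four variables, so a
    marginal of \<open>P\<close> evaluates it.\<close>
  have "?S (\<lambda>j x y z. log 2 (R j x y z)) =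
      ?S (\<lambda>j x y z. log 2 (real J * r j y)) - ?S (\<lambda>j x y z. log 2 (pmf (PJ j) z / pmf PZ z))
       - ?S (\<lambda>j x y z. log 2 (pmf (W x) y / pmf Q y)) + ?S (\<lambda>j x y z. log 2 (pmf (V x) z / pmf QZ z))"
    unfolding sum_subtractf[symmetric] sum.distrib[symmetric]
  proof (intro sum.cong refl)
    fix j x y z assume jx: "j \<in> {1..J}" "x \<in> X" "y \<in> Y"
    show "P j x y z * log 2 (R j x y z) =
      P j x y z * log 2 (real J * r j y) - P j x y z * log 2 (pmf (PJ j) z / pmf PZ z)
       - P j x y z * log 2 (pmf (W x) y / pmf Q y) + P j x y z * log 2 (pmf (V x) z / pmf QZ z)"
    proof (cases "P j x y z = 0")
      case False
      note p = pos[OF jx False]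
      have "log 2 (R j x y z) = log 2 (real J * r j y) - log 2 (pmf (PJ j) z / pmf PZ z)
          - log 2 (pmf (W x) y / pmf Q y) + log 2 (pmf (V x) z / pmf QZ z)"
        using p Jpos r_pos[of j y] by (simp add: R_def log_mult log_divide)
      then show ?thesis
        by (simp only: right_diff_distrib distrib_left)
    qed simp
  qed
  moreover have "?S (\<lambda>j x y z. log 2 (pmf (PJ j) z / pmf PZ z)) = mutual_info U PJ"
    unfolding marg_jz PZ_def using setU fin setPJ
    by (subst mutual_info_eq[of "{1..J}" U Z]) auto
  moreover have "?S (\<lambda>j x y z. log 2 (pmf (W x) y / pmf Q y)) =
      (\<Sum>x\<in>X. pmf (bind_pmf U E) x * divergence Y (W x) Q)"
    unfolding marg_xy divergence_def by simp
  moreover have "?S (\<lambda>j x y z. log 2 (pmf (V x) z / pmf QZ z)) =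
      (\<Sum>x\<in>X. pmf (bind_pmf U E) x * divergence Z (V x) QZ)"
    unfolding marg_xz divergence_def by simp
  moreover have "(1 - \<epsilon>) * log 2 (real J) - 1 \<le> ?S (\<lambda>j x y z. log 2 (real J * r j y))"
  proof -
    have logJ: "0 \<le> log 2 (real J)"
      using J by simp
    have "log 2 (real J) - 1 - log 2 (real J) * indicator (- D j) y \<le> log 2 (real J * r j y)" for j y
    proof (cases "y \<in> D j")
      case True
      have "log 2 (real J) - 1 = log 2 (real J * (1 / 2))"
        using Jpos by (simp add: log_divide)
      also have "\<dots> \<le> log 2 (real J * r j y)"
        using True Jpos by (subst log_le_cancel_iff) (auto simp: r_def add_pos_pos)
      finally show ?thesis
        using True by simp
    next
      case False
      then show ?thesis
        using Jpos by (simp add: r_def log_divide)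
    qed
    then have "?S (\<lambda>j x y z. log 2 (real J) - 1 - log 2 (real J) * indicator (- D j) y) \<le>
        ?S (\<lambda>j x y z. log 2 (real J * r j y))"
      by (intro sum_mono mult_left_mono P_nonneg)
    moreover have "?S (\<lambda>j x y z. log 2 (real J) - 1 - log 2 (real J) * indicator (- D j) y) =
        (log 2 (real J) - 1) * ?S (\<lambda>j x y z. 1) - log 2 (real J) * ?S (\<lambda>j x y z. indicator (- D j) y)"
      unfolding sum_distrib_left sum_subtractf[symmetric]
      by (intro sum.cong refl) (simp add: algebra_simps)
    moreover have "?S (\<lambda>j x y z. indicator (- D j) y) \<le> \<epsilon>"
    proof -
      have prob: "measure_pmf.prob (W x) (Y - D j) = (\<Sum>y\<in>Y. pmf (W x) y * indicator (- D j) y)" for x j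
        using fin by (subst measure_measure_pmf_finite)
          (auto intro!: sum.mono_neutral_cong_left split: split_indicator)
      have "?S (\<lambda>j x y z. indicator (- D j) y) =
          (\<Sum>j\<in>{1..J}. (\<Sum>x\<in>X. pmf (E j) x * measure_pmf.prob (W x) (Y - D j)) / real J)"
        unfolding marg_jy prob sum_distrib_left sum_divide_distrib by (simp add: mult.assoc)
      also have "\<dots> \<le> (\<Sum>j\<in>{1..J}. \<epsilon> / real J)"
        using err Jpos by (intro sum_mono divide_right_mono) auto
      finally show ?thesis
        using Jpos by simp
    qed
    ultimately show ?thesis
      using mult_left_mono[OF _ logJ, of "?S (\<lambda>j x y z. indicator (- D j) y)" \<epsilon>] total
      by (simp add: algebra_simps)
  qed
  ultimately have "(1 - \<epsilon>) * log 2 (real J) - 1 - mutual_info U PJ \<le>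
      (\<Sum>x\<in>X. pmf (bind_pmf U E) x * divergence Y (W x) Q) - (\<Sum>x\<in>X. pmf (bind_pmf U E) x * divergence Z (V x) QZ)"
    using main by linarith
  then show ?thesis
    unfolding PJ_def V_def QZ_def by (simp add: sum_subtractf right_diff_distrib)
qed

section \<open>Single-letterization of the divergence terms\<close>

lemma set_pmf_memoryless_ext_iid:
  assumes "xs \<in> words n" "\<And>x. x \<in> set xs \<Longrightarrow> set_pmf (W x) \<subseteq> set_pmf q"
  shows "set_pmf (memoryless_ext W xs) \<subseteq> set_pmf (iid n q)"
proof
  fix ys assume "ys \<in> set_pmf (memoryless_ext W xs)"
  then have ys: "length ys = length xs" "\<And>i. i < length xs \<Longrightarrow> ys ! i \<in> set_pmf (W (xs ! i))"
    by (simp_all add: set_pmf_memoryless_ext list_all2_conv_all_nth)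
  have "ys ! i \<in> set_pmf q" if "i < length ys" for i
    using ys that assms(2)[of "xs ! i"] by auto
  then show "ys \<in> set_pmf (iid n q)"
    using ys(1) assms(1) unfolding set_pmf_iid words_def by (simp add: subset_iff) (metis in_set_conv_nth)
qed

text \<open>Both word probabilities factor over the letters, so the logarithm is additive on the
  support. As the same \<open>q\<close> is used at every position, the sum depends only on the
  letter frequencies of \<open>xs\<close>.\<close>

lemma divergence_memoryless_ext:
  fixes W :: "'a \<Rightarrow> 'b::finite pmf"
  assumes "\<And>x. x \<in> set xs \<Longrightarrow> set_pmf (W x) \<subseteq> set_pmf q" and "length xs = n"
  shows "divergence (words n) (memoryless_ext W xs) (iid n q) =
    (\<Sum>i<n. divergence UNIV (W (xs ! i)) q)"
  using assms
proof (induction xs arbitrary: n)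
  case Nil
  then show ?case
    by (simp add: divergence_def words_0 pmf_iid_0)
next
  case (Cons x xs)
  define m where "m = length xs"
  have n: "n = Suc m"
    using Cons.prems by (simp add: m_def)
  have xs: "xs \<in> words m"
    by (simp add: m_def words_def)
  let ?w = "\<lambda>ys. pmf (memoryless_ext W xs) ys"
  let ?d = "\<lambda>ys. log 2 (?w ys / pmf (iid m q) ys)"
  have split: "pmf (W x) y * ?w ys * log 2 (pmf (W x) y * ?w ys / (pmf q y * pmf (iid m q) ys)) =
      pmf (W x) y * log 2 (pmf (W x) y / pmf q y) * ?w ys + pmf (W x) y * (?w ys * ?d ys)" for y ys
  proof (cases "pmf (W x) y = 0 \<or> ?w ys = 0")
    case False
    then have y: "y \<in> set_pmf (W x)" and ys: "ys \<in> set_pmf (memoryless_ext W xs)"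
      by (auto simp: set_pmf_iff)
    have "ys \<in> set_pmf (iid m q)"
      using set_pmf_memoryless_ext_iid[OF xs, of W q] ys Cons.prems(1) by auto
    then have "pmf (W x) y > 0" "pmf q y > 0" "?w ys > 0" "pmf (iid m q) ys > 0"
      using y ys Cons.prems(1)[of x] by (auto simp: pmf_positive_iff)
    then show ?thesis
      by (simp add: log_divide log_mult algebra_simps)
  qed auto
  have one: "(\<Sum>ys\<in>words m. ?w ys) = 1" "(\<Sum>y\<in>UNIV. pmf (W x) y) = 1"
    using set_pmf_memoryless_ext_words[OF xs] by (auto intro!: sum_pmf_eq_1)
  have "divergence (words n) (memoryless_ext W (x # xs)) (iid n q) =
      (\<Sum>y\<in>UNIV. pmf (W x) y * log 2 (pmf (W x) y / pmf q y) * (\<Sum>ys\<in>words m. ?w ys)) +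
      (\<Sum>y\<in>UNIV. pmf (W x) y * (\<Sum>ys\<in>words m. ?w ys * ?d ys))"
    unfolding divergence_def n sum_words_Suc pmf_memoryless_ext_Cons pmf_iid_Cons split
    by (simp add: sum.distrib sum_distrib_left)
  also have "\<dots> = divergence UNIV (W x) q + divergence (words m) (memoryless_ext W xs) (iid m q)"
    using one by (simp add: divergence_def flip: sum_distrib_right)
  also have "divergence (words m) (memoryless_ext W xs) (iid m q) =
      (\<Sum>i<m. divergence UNIV (W (xs ! i)) q)"
    using Cons by (simp add: m_def)
  finally show ?case
    by (simp add: n sum.lessThan_Suc_shift del: sum.lessThan_Suc)
qed

text \<open>The letter at a uniformly random position of a random word. For \<open>n = 0\<close> the
  uniform distribution on the empty set is meaningless, whence the assumption \<open>0 < n\<close>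
  later.\<close>

definition mean_letter :: "nat \<Rightarrow> 'a list pmf \<Rightarrow> 'a pmf" where
  "mean_letter n P = bind_pmf P (\<lambda>xs. map_pmf ((!) xs) (pmf_of_set {..<n}))"

lemma set_mean_letter:
  assumes "0 < n" "set_pmf P \<subseteq> words n" "xs \<in> set_pmf P"
  shows "set xs \<subseteq> set_pmf (mean_letter n P)"
proof
  fix x assume "x \<in> set xs"
  then obtain i where "i < n" "x = xs ! i"
    using assms by (auto simp: words_def in_set_conv_nth)
  moreover have "set_pmf (pmf_of_set {..<n}) = {..<n}"
    using assms(1) by (intro set_pmf_of_set) auto
  ultimately show "x \<in> set_pmf (mean_letter n P)"
    using assms(3) by (auto simp: mean_letter_def)
qed

lemma sum_mean_letter:
  fixes P :: "'a::finite list pmf"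
  assumes "0 < n" "set_pmf P \<subseteq> words n"
  shows "(\<Sum>xs\<in>words n. pmf P xs * (\<Sum>i<n. f (xs ! i))) =
    real n * (\<Sum>a\<in>UNIV. pmf (mean_letter n P) a * f a)"
proof -
  have "(\<Sum>a\<in>UNIV. pmf (mean_letter n P) a * f a) = measure_pmf.expectation (mean_letter n P) f"
    by (rule expectation_finite[symmetric]) auto
  also have "\<dots> = (\<Sum>xs\<in>words n. pmf P xs * ((\<Sum>i<n. f (xs ! i)) / real n))"
  proof -
    have ne: "{..<n} \<noteq> {}"
      using assms(1) by auto
    have "measure_pmf.expectation (pmf_of_set {..<n}) g = (\<Sum>i<n. g i) / real n" for g :: "nat \<Rightarrow> real"
      using ne by (subst integral_pmf_of_set) auto
    then show ?thesis
      unfolding mean_letter_def using assms ne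
      by (subst pmf_expectation_bind[where A = "words n"]) auto
  qed
  also have "\<dots> = (\<Sum>xs\<in>words n. pmf P xs * (\<Sum>i<n. f (xs ! i))) / real n"
    by (subst sum_divide_distrib) simp
  finally show ?thesis
    using assms(1) by simp
qed

lemma degraded_iff: "degraded W V \<longleftrightarrow> (\<exists>K. V = (\<lambda>x. bind_pmf (W x) K))"
proof -
  have "(\<forall>x z. pmf (V x) z = (\<Sum>y\<in>UNIV. pmf (W x) y * pmf (K y) z)) \<longleftrightarrow> V = (\<lambda>x. bind_pmf (W x) K)" for K
    by (auto simp: fun_eq_iff pmf_eq_iff pmf_bind_finite[of UNIV])
  then show ?thesis
    by (simp add: degraded_def)
qed

text \<open>The reference in \<open>one_shot_converse\<close> is the product of the output
  distribution that \<open>p\<close> induces through \<open>W\<close>. The degrading channel maps it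
  to the product of the output distribution that \<open>p\<close> induces through \<open>V\<close>,
  so both divergences average to mutual informations of the same \<open>p\<close>, with
  equality.\<close>

lemma converse_block:
  fixes W :: "'a::finite \<Rightarrow> 'b::finite pmf" and V :: "'a \<Rightarrow> 'c::finite pmf"
    and E :: "nat \<Rightarrow> 'a list pmf"
  assumes J: "1 \<le> J" and n: "0 < n" and deg: "degraded W V"
    and E: "\<And>j. j \<in> {1..J} \<Longrightarrow> set_pmf (E j) \<subseteq> words n"
    and D: "disjoint_family_on D {1..J}"
    and err: "\<And>j. j \<in> {1..J} \<Longrightarrow>
      (\<Sum>xs\<in>words n. pmf (E j) xs * measure_pmf.prob (memoryless_ext W xs) (words n - D j)) \<le> \<epsilon>"
  defines "p \<equiv> mean_letter n (bind_pmf (pmf_of_set {1..J}) E)"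
  shows "(1 - \<epsilon>) * log 2 (real J) - 1
      - mutual_info (pmf_of_set {1..J}) (\<lambda>j. bind_pmf (E j) (memoryless_ext V))
    \<le> real n * (mutual_info p W - mutual_info p V)"
proof -
  obtain K where K: "V = (\<lambda>x. bind_pmf (W x) K)"
    using deg by (auto simp: degraded_iff)
  define P where "P = bind_pmf (pmf_of_set {1..J}) E"
  have setU: "set_pmf (pmf_of_set {1..J}) = {1..J}"
    using J by (subst set_pmf_of_set) simp_all
  have P: "set_pmf P \<subseteq> words n"
    unfolding P_def set_bind_pmf setU using E by blast
  have supp: "x \<in> set_pmf p" if "xs \<in> set_pmf P" "x \<in> set xs" for xs x
    using set_mean_letter[OF n P that(1)] that(2) unfolding p_def P_def by blast
  let ?q = "bind_pmf p W"
  have W_q: "set_pmf (W x) \<subseteq> set_pmf ?q" and V_q: "set_pmf (V x) \<subseteq> set_pmf (bind_pmf ?q K)"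
    if "xs \<in> set_pmf P" "x \<in> set xs" for xs x
    using supp[OF that] unfolding K set_bind_pmf by blast+
  have comp: "(\<lambda>xs. bind_pmf (memoryless_ext W xs) (memoryless_ext K)) = memoryless_ext V"
    by (simp add: memoryless_ext_compose K fun_eq_iff)
  have "(1 - \<epsilon>) * log 2 (real J) - 1
      - mutual_info (pmf_of_set {1..J}) (\<lambda>j. bind_pmf (E j) (\<lambda>xs. bind_pmf (memoryless_ext W xs) (memoryless_ext K)))
    \<le> (\<Sum>xs\<in>words n. pmf (bind_pmf (pmf_of_set {1..J}) E) xs *
          (divergence (words n) (memoryless_ext W xs) (iid n ?q) -
          divergence (words n) (bind_pmf (memoryless_ext W xs) (memoryless_ext K))
            (bind_pmf (iid n ?q) (memoryless_ext K))))"
  proof (rule one_shot_converse[OF J finite_words finite_words finite_words E _ _ _ _ D err])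
    fix j xs assume j: "j \<in> {1..J}" "xs \<in> set_pmf (E j)"
    then have xs: "xs \<in> set_pmf P"
      by (auto simp: P_def setU)
    show "set_pmf (memoryless_ext W xs) \<subseteq> set_pmf (iid n ?q)"
      using P W_q[OF xs] by (intro set_pmf_memoryless_ext_iid subsetD[OF P xs]) blast
  next
    show "set_pmf (iid n ?q) \<subseteq> words n"
      unfolding set_pmf_iid by blast
  qed (use set_pmf_memoryless_ext_words in blast)+
  also have "\<dots> = (\<Sum>xs\<in>words n. pmf P xs * (\<Sum>i<n. divergence UNIV (W (xs ! i)) ?q -
          divergence UNIV (V (xs ! i)) (bind_pmf ?q K)))"
    unfolding P_def[symmetric]
  proof (rule sum.cong[OF refl])
    fix xs :: "'a list" assume xs: "xs \<in> words n"
    show "pmf P xs * (divergence (words n) (memoryless_ext W xs) (iid n ?q) -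
          divergence (words n) (bind_pmf (memoryless_ext W xs) (memoryless_ext K))
            (bind_pmf (iid n ?q) (memoryless_ext K))) =
        pmf P xs * (\<Sum>i<n. divergence UNIV (W (xs ! i)) ?q -
          divergence UNIV (V (xs ! i)) (bind_pmf ?q K))"
    proof (cases "xs \<in> set_pmf P")
      case True
      have "divergence (words n) (memoryless_ext W xs) (iid n ?q) = (\<Sum>i<n. divergence UNIV (W (xs ! i)) ?q)"
        using W_q[OF True] xs by (intro divergence_memoryless_ext) (auto simp: words_def)
      moreover have "divergence (words n) (memoryless_ext V xs) (iid n (bind_pmf ?q K)) =
          (\<Sum>i<n. divergence UNIV (V (xs ! i)) (bind_pmf ?q K))"
        using V_q[OF True] xs by (intro divergence_memoryless_ext) (auto simp: words_def)
      ultimately show ?thesis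
        by (simp add: memoryless_ext_compose bind_iid K sum_subtractf)
    qed (simp add: set_pmf_iff)
  qed
  also have "\<dots> = real n * (\<Sum>a\<in>UNIV. pmf p a * (divergence UNIV (W a) ?q - divergence UNIV (V a) (bind_pmf ?q K)))"
    using sum_mean_letter[OF n P] by (simp add: p_def P_def)
  also have "\<dots> = real n * (mutual_info p W - mutual_info p V)"
    by (simp add: mutual_info_eq_divergence[of UNIV p UNIV] K bind_assoc_pmf right_diff_distrib sum_subtractf)
  finally show ?thesis
    by (simp add: comp)
qed

section \<open>Exponential moments of the information density\<close>

text \<open>The difference \<open>h\<close> of the two sides vanishes at 0, and its derivative there
  is the mean of \<open>ln v\<close> minus \<open>\<mu> * ln 2\<close>, which is negative; so it is
  negative just to the right of 0. Capping \<open>s\<close> at 1 is needed for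
  \<open>log_one_plus_le_powr\<close>.\<close>

lemma moment_bound:
  fixes w v :: "'i \<Rightarrow> real"
  assumes fin: "finite I" and w: "\<And>i. i \<in> I \<Longrightarrow> 0 \<le> w i" "(\<Sum>i\<in>I. w i) = 1"
    and v: "\<And>i. i \<in> I \<Longrightarrow> w i \<noteq> 0 \<Longrightarrow> 0 < v i"
    and \<mu>: "(\<Sum>i\<in>I. w i * log 2 (v i)) < \<mu>"
  shows "\<exists>s. 0 < s \<and> s \<le> 1 \<and> (\<Sum>i\<in>I. w i * v i powr s) \<le> 2 powr (s * \<mu>)"
proof -
  define h where "h s = (\<Sum>i\<in>I. w i * exp (s * ln (v i))) - exp (s * (\<mu> * ln 2))" for s
  have "(h has_real_derivative
      (\<Sum>i\<in>I. w i * (exp (0 * ln (v i)) * ln (v i))) - exp (0 * (\<mu> * ln 2)) * (\<mu> * ln 2)) (at 0)"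
    unfolding h_def by (auto intro!: derivative_eq_intros sum.cong)
  moreover have "(\<Sum>i\<in>I. w i * (exp (0 * ln (v i)) * ln (v i))) - exp (0 * (\<mu> * ln 2)) * (\<mu> * ln 2) < 0"
  proof -
    have "(\<Sum>i\<in>I. w i * ln (v i)) = (\<Sum>i\<in>I. w i * log 2 (v i)) * ln 2"
      by (simp add: sum_distrib_right log_def)
    then show ?thesis
      using \<mu> by simp
  qed
  ultimately obtain d where d: "d > 0" "\<And>s. 0 < s \<Longrightarrow> s < d \<Longrightarrow> h (0 + s) < h 0"
    using DERIV_neg_dec_right by blast
  define s where "s = min 1 (d / 2)"
  have s: "0 < s" "s \<le> 1" "s < d"
    using d(1) by (auto simp: s_def min_def)
  have "h s < 0"
    using d(2)[OF s(1,3)] w(2) by (simp add: h_def)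
  moreover have "(\<Sum>i\<in>I. w i * v i powr s) = (\<Sum>i\<in>I. w i * exp (s * ln (v i)))"
    using v by (intro sum.cong refl) (force simp: powr_def)
  moreover have "2 powr (s * \<mu>) = exp (s * (\<mu> * ln 2))"
    by (simp add: powr_def mult.assoc)
  ultimately show ?thesis
    using s unfolding h_def by (intro exI[of _ s]) auto
qed

text \<open>For \<open>u \<le> 1\<close> the chain is
  \<open>ln (1 + u) \<le> u \<le> u powr s\<close>. For larger \<open>u\<close> it is
  \<open>ln (2 * u) = ln ((2 * u) powr s) / s\<close>, and this case dictates the factor
  \<open>2 / s\<close>. Logarithmic costs become moments that factor over letters.\<close>

lemma log_one_plus_le_powr:
  assumes "0 \<le> u" "0 < s" "s \<le> 1"
  shows "log 2 (1 + u) \<le> 2 / (s * ln 2) * u powr s"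
proof -
  have "ln (1 + u) \<le> 2 / s * u powr s"
  proof (cases "u \<le> 1")
    case True
    have "ln (1 + u) \<le> u"
      using assms by (intro ln_add_one_self_le_self)
    also have "u \<le> u powr s"
      using assms True powr_mono'[of s 1 u] by (cases "u = 0") auto
    also have "u powr s \<le> 2 / s * u powr s"
      using assms by (intro mult_le_cancel_right1[THEN iffD2]) (auto simp: field_simps)
    finally show ?thesis .
  next
    case False
    have "ln (1 + u) \<le> ln (2 * u)"
      using False by simp
    also have "\<dots> = ln ((2 * u) powr s) / s"
      using False assms by (simp add: ln_powr)
    also have "\<dots> \<le> (2 * u) powr s / s"
      using False assms by (intro divide_right_mono ln_bound) auto
    also have "\<dots> = 2 powr s * u powr s / s"
      using False by (simp add: powr_mult)
    also have "\<dots> \<le> 2 powr 1 * u powr s / s"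
      using assms by (intro divide_right_mono mult_right_mono powr_mono) auto
    finally show ?thesis
      by simp
  qed
  then show ?thesis
    by (simp add: log_def divide_right_mono field_simps)
qed

text \<open>The exponential moment of the information density \<open>log (W(y|x) / q(y))\<close>.\<close>

definition info_moment :: "'a set \<Rightarrow> 'b set \<Rightarrow> 'a pmf \<Rightarrow> ('a \<Rightarrow> 'b pmf) \<Rightarrow> real \<Rightarrow> real" where
  "info_moment X Y p W s =
    (\<Sum>x\<in>X. \<Sum>y\<in>Y. pmf p x * pmf (W x) y * (pmf (W x) y / pmf (bind_pmf p W) y) powr s)"

lemma info_moment_nonneg: "0 \<le> info_moment X Y p W s"
  unfolding info_moment_def by (intro sum_nonneg) auto

text \<open>Weights and density are products over the letters, so the moment is multiplicative. A
  single-letter bound on it therefore acts as an exponent in \<open>n\<close>.\<close>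

lemma info_moment_memoryless_ext:
  fixes p :: "'a::finite pmf" and W :: "'a \<Rightarrow> 'b::finite pmf"
  shows "info_moment (words n) (words n) (iid n p) (memoryless_ext W) s =
    info_moment UNIV UNIV p W s ^ n"
proof (induction n)
  case 0
  then show ?case
    by (simp add: info_moment_def words_0 bind_iid pmf_iid_0)
next
  case (Suc n)
  let ?q = "bind_pmf p W"
  let ?d = "\<lambda>x y. (pmf (W x) y / pmf ?q y) powr s"
  let ?D = "\<lambda>xs ys. (pmf (memoryless_ext W xs) ys / pmf (iid n ?q) ys) powr s"
  have "info_moment (words (Suc n)) (words (Suc n)) (iid (Suc n) p) (memoryless_ext W) s =
      (\<Sum>x\<in>UNIV. \<Sum>xs\<in>words n. \<Sum>y\<in>UNIV. \<Sum>ys\<in>words n. pmf p x * pmf (W x) y * ?d x y *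
        (pmf (iid n p) xs * pmf (memoryless_ext W xs) ys * ?D xs ys))"
    unfolding info_moment_def bind_iid sum_words_Suc pmf_memoryless_ext_Cons pmf_iid_Cons
  proof (intro sum.cong refl, goal_cases)
    case (1 x xs y ys)
    have "(pmf (W x) y * pmf (memoryless_ext W xs) ys / (pmf ?q y * pmf (iid n ?q) ys)) powr s =
        ?d x y * ?D xs ys"
      by (simp flip: powr_mult)
    then show ?case
      by (simp add: mult_ac)
  qed
  also have "\<dots> = (\<Sum>x\<in>UNIV. \<Sum>y\<in>UNIV. \<Sum>xs\<in>words n. \<Sum>ys\<in>words n. pmf p x * pmf (W x) y * ?d x y *
        (pmf (iid n p) xs * pmf (memoryless_ext W xs) ys * ?D xs ys))"
    by (intro sum.cong refl sum.swap)
  also have "\<dots> = info_moment UNIV UNIV p W s * info_moment (words n) (words n) (iid n p) (memoryless_ext W) s"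
    unfolding info_moment_def bind_iid by (simp only: sum_distrib_right, simp only: sum_distrib_left)
  finally show ?case
    by (simp add: Suc.IH)
qed

text \<open>\<open>moment_bound\<close> is applied to the likelihood ratio and to its inverse, whose
  mean logarithms are plus and minus the mutual information; \<open>\<delta>\<close> supplies
  strictness. The first bound serves the eavesdropper, where large densities hurt, the second the
  receiver, where small ones do.\<close>

lemma info_moment_bounds:
  fixes p :: "'a::finite pmf" and W :: "'a \<Rightarrow> 'b::finite pmf"
  assumes "0 < \<delta>"
  shows "\<exists>s. 0 < s \<and> s \<le> 1 \<and> info_moment UNIV UNIV p W s \<le> 2 powr (s * (mutual_info p W + \<delta>))"
    and "\<exists>s. 0 < s \<and> s \<le> 1 \<and> info_moment UNIV UNIV p W (- s) \<le> 2 powr (- s * (mutual_info p W - \<delta>))"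
proof -
  let ?q = "bind_pmf p W"
  define w where "w z = pmf p (fst z) * pmf (W (fst z)) (snd z)" for z
  define v where "v z = pmf (W (fst z)) (snd z) / pmf ?q (snd z)" for z
  have pos: "0 < v z" if "w z \<noteq> 0" for z
  proof -
    have "fst z \<in> set_pmf p" "snd z \<in> set_pmf (W (fst z))"
      using that by (auto simp: w_def set_pmf_iff)
    then have "snd z \<in> set_pmf ?q"
      by auto
    then show ?thesis
      using that by (auto simp: v_def w_def pmf_positive intro!: divide_pos_pos)
  qed
  have w: "(\<Sum>z\<in>UNIV. w z) = 1" "\<And>z. 0 \<le> w z"
  proof -
    have "(\<Sum>z\<in>UNIV. w z) = (\<Sum>x\<in>UNIV. \<Sum>y\<in>UNIV. pmf p x * pmf (W x) y)"
      by (simp add: w_def sum.cartesian_product case_prod_beta' flip: UNIV_Times_UNIV)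
    then show "(\<Sum>z\<in>UNIV. w z) = 1"
      by (simp add: sum_pmf_eq_1 flip: sum_distrib_left)
  qed (simp add: w_def)
  have I: "(\<Sum>z\<in>UNIV. w z * log 2 (v z)) = mutual_info p W"
    by (subst mutual_info_eq[of UNIV p UNIV])
      (simp_all add: w_def v_def sum.cartesian_product case_prod_beta' flip: UNIV_Times_UNIV)
  have moment: "info_moment UNIV UNIV p W s = (\<Sum>z\<in>UNIV. w z * v z powr s)" for s
    by (simp add: info_moment_def w_def v_def sum.cartesian_product case_prod_beta' flip: UNIV_Times_UNIV)
  show "\<exists>s. 0 < s \<and> s \<le> 1 \<and> info_moment UNIV UNIV p W s \<le> 2 powr (s * (mutual_info p W + \<delta>))"
    unfolding moment by (rule moment_bound) (use assms pos w I in auto)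
  have "\<exists>s. 0 < s \<and> s \<le> 1 \<and> (\<Sum>z\<in>UNIV. w z * inverse (v z) powr s) \<le> 2 powr (s * (- mutual_info p W + \<delta>))"
  proof (rule moment_bound)
    have "(\<Sum>z\<in>UNIV. w z * log 2 (inverse (v z))) = - mutual_info p W"
      unfolding I[symmetric] sum_negf[symmetric]
      using pos by (intro sum.cong refl) (metis log_inverse mult_minus_right mult_zero_left neg_equal_0_iff_equal)
    then show "(\<Sum>z\<in>UNIV. w z * log 2 (inverse (v z))) < - mutual_info p W + \<delta>"
      using assms by simp
  qed (use pos w in auto)
  moreover have "w z * inverse (v z) powr s = w z * v z powr (- s)" for z s
    using pos[of z] by (cases "w z = 0") (auto simp: powr_minus inverse_powr)
  ultimately show "\<exists>s. 0 < s \<and> s \<le> 1 \<and> info_moment UNIV UNIV p W (- s) \<le> 2 powr (- s * (mutual_info p W - \<delta>))"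
    unfolding moment by (simp add: algebra_simps)
qed

text \<open>Chernoff's bound: on the event, \<open>\<theta>\<close> divided by the likelihood ratio
  is at least 1, and so is its power of order \<open>s\<close>.\<close>

lemma threshold_miss_bound:
  assumes fin: "finite X" "finite Y" "set_pmf p \<subseteq> X" and s: "0 < s" and \<theta>: "0 < \<theta>"
  shows "(\<Sum>x\<in>X. pmf p x * measure_pmf.prob (W x) {y\<in>Y. pmf (W x) y \<le> \<theta> * pmf (bind_pmf p W) y})
    \<le> \<theta> powr s * info_moment X Y p W (- s)"
proof -
  let ?q = "bind_pmf p W"
  have "pmf p x * measure_pmf.prob (W x) {y\<in>Y. pmf (W x) y \<le> \<theta> * pmf ?q y} \<le>
      (\<Sum>y\<in>Y. \<theta> powr s * (pmf p x * pmf (W x) y * (pmf (W x) y / pmf ?q y) powr (- s)))" for x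
  proof -
    have "pmf p x * measure_pmf.prob (W x) {y\<in>Y. pmf (W x) y \<le> \<theta> * pmf ?q y} =
        (\<Sum>y\<in>{y\<in>Y. pmf (W x) y \<le> \<theta> * pmf ?q y}. pmf p x * pmf (W x) y)"
      using fin by (simp add: measure_measure_pmf_finite sum_distrib_left)
    also have "\<dots> \<le> (\<Sum>y\<in>{y\<in>Y. pmf (W x) y \<le> \<theta> * pmf ?q y}.
        \<theta> powr s * (pmf p x * pmf (W x) y * (pmf (W x) y / pmf ?q y) powr (- s)))"
    proof (rule sum_mono)
      fix y assume y: "y \<in> {y\<in>Y. pmf (W x) y \<le> \<theta> * pmf ?q y}"
      show "pmf p x * pmf (W x) y \<le>
          \<theta> powr s * (pmf p x * pmf (W x) y * (pmf (W x) y / pmf ?q y) powr (- s))"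
      proof (cases "pmf p x * pmf (W x) y = 0")
        case False
        then have "x \<in> set_pmf p" "y \<in> set_pmf (W x)"
          by (auto simp: set_pmf_iff)
        then have pos: "0 < pmf (W x) y" "0 < pmf ?q y"
          by (auto simp: pmf_positive_iff)
        have "1 \<le> (\<theta> / (pmf (W x) y / pmf ?q y)) powr s"
          using y pos s by (intro ge_one_powr_ge_zero) (auto simp: field_simps)
        also have "\<dots> = \<theta> powr s * (pmf (W x) y / pmf ?q y) powr (- s)"
          using \<theta> pos by (simp add: powr_divide powr_minus_divide powr_mult)
        finally have "1 \<le> \<theta> powr s * (pmf (W x) y / pmf ?q y) powr (- s)" .
        from mult_left_mono[OF this, of "pmf p x * pmf (W x) y"] show ?thesis
          by (simp add: mult_ac)
      qed auto
    qed
    also have "\<dots> \<le> (\<Sum>y\<in>Y. \<theta> powr s * (pmf p x * pmf (W x) y * (pmf (W x) y / pmf ?q y) powr (- s)))"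
      using fin by (intro sum_mono2) auto
    finally show ?thesis .
  qed
  then show ?thesis
    unfolding info_moment_def sum_distrib_left by (intro sum_mono)
qed

text \<open>The left side is the expected cost of covering the output distribution with
  \<open>l\<close> random codewords. The power bound on the logarithm pulls \<open>l\<close> out as
  \<open>l powr (- s)\<close>, to be played off against the growth of the moment.\<close>

lemma resolvability_moment_bound:
  assumes s: "0 < s" "s \<le> 1" and l: "0 < l"
  shows "(\<Sum>x\<in>X. \<Sum>z\<in>Z. pmf p x * pmf (V x) z * log 2 (1 + pmf (V x) z / (l * pmf (bind_pmf p V) z)))
    \<le> 2 / (s * ln 2) * l powr (- s) * info_moment X Z p V s"
  unfolding info_moment_def sum_distrib_left
proof (intro sum_mono)
  fix x z
  let ?u = "pmf (V x) z / pmf (bind_pmf p V) z"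
  have "log 2 (1 + ?u / l) \<le> 2 / (s * ln 2) * (?u / l) powr s"
    using s l by (intro log_one_plus_le_powr) auto
  also have "\<dots> = 2 / (s * ln 2) * l powr (- s) * ?u powr s"
    using l by (simp add: powr_divide powr_minus_divide powr_mult)
  finally have "pmf p x * pmf (V x) z * log 2 (1 + ?u / l) \<le>
      pmf p x * pmf (V x) z * (2 / (s * ln 2) * l powr (- s) * ?u powr s)"
    by (intro mult_left_mono) auto
  then show "pmf p x * pmf (V x) z * log 2 (1 + pmf (V x) z / (l * pmf (bind_pmf p V) z)) \<le>
      2 / (s * ln 2) * l powr (- s) * (pmf p x * pmf (V x) z * ?u powr s)"
    by (simp add: mult_ac)
qed

section \<open>Random coding\<close>

lemma pmf_exists_le_expectation:
  fixes f :: "'a \<Rightarrow> real"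
  assumes "finite (set_pmf C)" "measure_pmf.expectation C f \<le> a"
  shows "\<exists>c\<in>set_pmf C. f c \<le> a"
proof (rule ccontr)
  assume "\<not> ?thesis"
  then have gt: "\<And>c. c \<in> set_pmf C \<Longrightarrow> a < f c"
    by force
  have "(\<Sum>c\<in>set_pmf C. pmf C c * a) < (\<Sum>c\<in>set_pmf C. pmf C c * f c)"
    using assms(1) gt by (intro sum_strict_mono) (auto simp: pmf_positive set_pmf_not_empty)
  then show False
    using assms by (simp add: expectation_finite[of "set_pmf C"] sum_pmf_eq_1 flip: sum_distrib_right)
qed

lemma map_pmf_Pi_pmf_pair:
  assumes "finite I" "i \<in> I" "i' \<in> I" "i \<noteq> i'"
  shows "map_pmf (\<lambda>c. (c i, c i')) (Pi_pmf I d p) = pair_pmf (p i) (p i')"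
proof -
  have I: "I = insert i (I - {i})"
    using assms by auto
  have "Pi_pmf I d p = map_pmf (\<lambda>(y, f). f(i := y)) (pair_pmf (p i) (Pi_pmf (I - {i}) d p))"
    using assms by (subst I, subst Pi_pmf_insert) auto
  then have "map_pmf (\<lambda>c. (c i, c i')) (Pi_pmf I d p) =
      map_pmf (\<lambda>(y, f). (y, f i')) (pair_pmf (p i) (Pi_pmf (I - {i}) d p))"
    using assms by (simp add: pmf.map_comp o_def case_prod_beta')
  also have "\<dots> = pair_pmf (p i) (map_pmf (\<lambda>f. f i') (Pi_pmf (I - {i}) d p))"
    by (simp add: pair_map_pmf2 apsnd_def map_prod_def id_def)
  also have "map_pmf (\<lambda>f. f i') (Pi_pmf (I - {i}) d p) = p i'"
    using assms by (subst Pi_pmf_component) auto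
  finally show ?thesis .
qed

lemma expectation_Pi_pmf_component:
  fixes f :: "'x \<Rightarrow> real"
  assumes "finite I" "i \<in> I" "finite X" "set_pmf (p i) \<subseteq> X"
  shows "measure_pmf.expectation (Pi_pmf I d p) (\<lambda>c. f (c i)) = (\<Sum>x\<in>X. pmf (p i) x * f x)"
proof -
  have "measure_pmf.expectation (Pi_pmf I d p) (\<lambda>c. f (c i)) =
      measure_pmf.expectation (map_pmf (\<lambda>c. c i) (Pi_pmf I d p)) f"
    by simp
  also have "\<dots> = measure_pmf.expectation (p i) f"
    using assms by (subst Pi_pmf_component) auto
  finally show ?thesis
    using assms by (simp add: expectation_finite)
qed

lemma expectation_Pi_pmf_pair:
  fixes f :: "'x \<Rightarrow> 'x \<Rightarrow> real"
  assumes "finite I" "i \<in> I" "i' \<in> I" "i \<noteq> i'" "finite X" "set_pmf (p i) \<subseteq> X" "set_pmf (p i') \<subseteq> X"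
  shows "measure_pmf.expectation (Pi_pmf I d p) (\<lambda>c. f (c i) (c i')) =
    (\<Sum>x\<in>X. pmf (p i) x * (\<Sum>x'\<in>X. pmf (p i') x' * f x x'))"
proof -
  have "measure_pmf.expectation (Pi_pmf I d p) (\<lambda>c. f (c i) (c i')) =
      measure_pmf.expectation (map_pmf (\<lambda>c. (c i, c i')) (Pi_pmf I d p)) (\<lambda>(x, x'). f x x')"
    by simp
  also have "\<dots> = measure_pmf.expectation (pair_pmf (p i) (p i')) (\<lambda>(x, x'). f x x')"
    using assms by (subst map_pmf_Pi_pmf_pair) auto
  also have "\<dots> = (\<Sum>z\<in>X \<times> X. pmf (pair_pmf (p i) (p i')) z * (case z of (x, x') \<Rightarrow> f x x'))"
    using assms by (intro expectation_finite) auto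
  also have "\<dots> = (\<Sum>x\<in>X. \<Sum>x'\<in>X. pmf (p i) x * pmf (p i') x' * f x x')"
    by (simp add: sum.cartesian_product case_prod_beta' pmf_pair[symmetric])
  finally show ?thesis
    by (simp add: sum_distrib_left mult.assoc)
qed

text \<open>On a hit the indicator is at most \<open>pmf (W x) y / (\<theta> * q)\<close>, where
  \<open>q\<close> is the output mass of \<open>y\<close>; averaging over \<open>p\<close> turns the
  numerator into \<open>q\<close>. The output \<open>y\<close> is fixed, so its true distribution
  does not matter.\<close>

lemma threshold_hit_bound:
  assumes fin: "finite X" "set_pmf p \<subseteq> X" and \<theta>: "0 < \<theta>"
  shows "(\<Sum>x\<in>X. pmf p x * of_bool (\<theta> * pmf (bind_pmf p W) y < pmf (W x) y)) \<le> 1 / \<theta>"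
proof -
  let ?q = "pmf (bind_pmf p W) y"
  have q: "?q = (\<Sum>x\<in>X. pmf p x * pmf (W x) y)"
    using fin by (rule pmf_bind_finite)
  show ?thesis
  proof (cases "?q = 0")
    \<comment> \<open>The test is a strict inequality: at an output of zero mass both sides are 0
      for every input in the support, and nothing is hit.\<close>
    case True
    then have "y \<notin> set_pmf (bind_pmf p W)"
      by (metis set_pmf_iff)
    then have "pmf p x * of_bool (\<theta> * ?q < pmf (W x) y) = 0" for x
      using True by (auto simp: set_pmf_iff)
    then have "(\<Sum>x\<in>X. pmf p x * of_bool (\<theta> * ?q < pmf (W x) y)) = 0"
      by (intro sum.neutral ballI)
    then show ?thesis
      using \<theta> by simp
  next
    case False
    then have qpos: "0 < ?q"
      by (simp add: order_less_le)
    have "(\<Sum>x\<in>X. pmf p x * of_bool (\<theta> * ?q < pmf (W x) y)) \<le> (\<Sum>x\<in>X. pmf p x * (pmf (W x) y / (\<theta> * ?q)))"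
      using qpos \<theta> by (intro sum_mono mult_left_mono) (auto simp: of_bool_def field_simps)
    also have "\<dots> = ?q / (\<theta> * ?q)"
      by (simp add: q sum_divide_distrib)
    finally show ?thesis
      using qpos by simp
  qed
qed

definition encoder :: "(nat \<Rightarrow> 'x) \<Rightarrow> nat \<Rightarrow> 'x pmf" where
  "encoder c L = map_pmf c (pmf_of_set {1..L})"

lemma set_pmf_encoder: "1 \<le> L \<Longrightarrow> set_pmf (encoder c L) = c ` {1..L}"
  by (simp add: encoder_def)

lemma expectation_encoder:
  fixes f :: "'x \<Rightarrow> real"
  assumes "1 \<le> L"
  shows "measure_pmf.expectation (encoder c L) f = (\<Sum>l\<in>{1..L}. f (c l)) / real L"
  using assms unfolding encoder_def by (simp add: integral_pmf_of_set)

lemma pmf_bind_encoder: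
  assumes "1 \<le> L"
  shows "pmf (bind_pmf (encoder c L) V) z = (\<Sum>l\<in>{1..L}. pmf (V (c l)) z) / real L"
  using expectation_encoder[OF assms, of c "\<lambda>x. pmf (V x) z"] by (simp add: pmf_bind)

text \<open>Concavity of the logarithm, used through its tangent at \<open>1 + V(z|c\<^sub>l) / (L q(z))\<close>: after
  averaging over the other codewords the linear term becomes nonpositive.\<close>

lemma divergence_encoder_le:
  fixes V :: "'x \<Rightarrow> 'z pmf"
  assumes L: "1 \<le> L" and Z: "finite Z"
    and q: "\<And>l. l \<in> {1..L} \<Longrightarrow> set_pmf (V (c l)) \<subseteq> set_pmf q"
  defines "u \<equiv> \<lambda>x z. 1 + pmf (V x) z / (real L * pmf q z)"
  shows "divergence Z (bind_pmf (encoder c L) V) q \<le>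
    (\<Sum>l\<in>{1..L}. \<Sum>z\<in>Z. pmf (V (c l)) z * log 2 (u (c l) z) +
      pmf (V (c l)) z / u (c l) z / ln 2 *
        ((\<Sum>l'\<in>{1..L} - {l}. pmf (V (c l')) z / (real L * pmf q z)) - 1)) / real L"
proof -
  let ?P = "\<lambda>z. pmf (bind_pmf (encoder c L) V) z"
  have Lpos: "0 < real L"
    using L by simp
  have P: "?P z = (\<Sum>l\<in>{1..L}. pmf (V (c l)) z) / real L" for z
    by (rule pmf_bind_encoder[OF L])
  have "divergence Z (bind_pmf (encoder c L) V) q =
      (\<Sum>l\<in>{1..L}. \<Sum>z\<in>Z. pmf (V (c l)) z * log 2 (?P z / pmf q z)) / real L"
    unfolding divergence_def by (subst sum.swap) (simp add: P sum_distrib_right sum_divide_distrib)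
  also have "\<dots> \<le> (\<Sum>l\<in>{1..L}. \<Sum>z\<in>Z. pmf (V (c l)) z * log 2 (u (c l) z) +
      pmf (V (c l)) z / u (c l) z / ln 2 *
        ((\<Sum>l'\<in>{1..L} - {l}. pmf (V (c l')) z / (real L * pmf q z)) - 1)) / real L"
  proof (intro divide_right_mono sum_mono)
    fix l z assume l: "l \<in> {1..L}"
    let ?v = "pmf (V (c l)) z"
    let ?u = "u (c l) z"
    let ?r = "\<Sum>l'\<in>{1..L} - {l}. pmf (V (c l')) z / (real L * pmf q z)"
    show "?v * log 2 (?P z / pmf q z) \<le> ?v * log 2 ?u + ?v / ?u / ln 2 * (?r - 1)"
    proof (cases "?v = 0")
      case False
      then have "z \<in> set_pmf (V (c l))"
        by (simp add: set_pmf_iff)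
      moreover from this have "z \<in> set_pmf q"
        using q[OF l] by auto
      ultimately have v: "0 < ?v" and qz: "0 < pmf q z"
        by (auto simp: pmf_positive_iff)
      have u: "0 < ?u"
        unfolding u_def using Lpos qz v by (intro add_pos_pos divide_pos_pos mult_pos_pos) auto
      \<comment> \<open>The codeword \<open>c l\<close> contributes \<open>?u - 1\<close> and the
        others contribute \<open>?r\<close>. Under independent drawing \<open>?r\<close> has mean at
        most 1, and replacing it by 1 gives the tangent point \<open>?u\<close>.\<close>
      have Pz: "?P z / pmf q z = ?u - 1 + ?r"
      proof -
        have "(\<Sum>l'\<in>{1..L}. pmf (V (c l')) z) = ?v + (\<Sum>l'\<in>{1..L} - {l}. pmf (V (c l')) z)"
          using l by (intro sum.remove) auto
        then show ?thesis
          by (simp add: P u_def add_divide_distrib flip: sum_divide_distrib)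
      qed
      have "0 \<le> ?r"
        by (intro sum_nonneg) auto
      then have Ppos: "0 < ?P z / pmf q z"
        unfolding Pz using Lpos qz v by (auto simp: u_def intro!: add_pos_nonneg divide_pos_pos mult_pos_pos)
      have tangent: "log 2 a \<le> log 2 b + (a / b - 1) / ln 2" if "0 < a" "0 < b" for a b :: real
      proof -
        have "ln (a / b) \<le> a / b - 1"
          using that by (intro ln_le_minus_one) simp
        then have "ln a / ln 2 \<le> (ln b + (a / b - 1)) / ln 2"
          using that by (intro divide_right_mono) (auto simp: ln_div)
        then show ?thesis
          by (simp add: log_def add_divide_distrib)
      qed
      have "log 2 (?P z / pmf q z) \<le> log 2 ?u + (?P z / pmf q z / ?u - 1) / ln 2"
        by (rule tangent[OF Ppos u])
      also have "?P z / pmf q z / ?u - 1 = (?r - 1) / ?u"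
        unfolding Pz using u by (simp add: field_simps)
      finally have "?v * log 2 (?P z / pmf q z) \<le> ?v * (log 2 ?u + (?r - 1) / ?u / ln 2)"
        using v by (intro mult_left_mono) auto
      also have "\<dots> = ?v * log 2 ?u + ?v / ?u / ln 2 * (?r - 1)"
        by (simp only: distrib_left times_divide_eq_left times_divide_eq_right)
      finally show ?thesis .
    qed simp
  qed simp
  finally show ?thesis .
qed

text \<open>A one-shot setting: a whole word counts as one letter of \<open>X\<close>,
  \<open>Y\<close> or \<open>Z\<close>. \<open>K\<close> is the number of messages before
  expurgation, \<open>L t\<close> the number of randomization indices, and \<open>\<theta> t\<close>
  a threshold on the likelihood ratio itself, not on its logarithm.\<close>

locale random_code =
  fixes T S K :: nat and L :: "nat \<Rightarrow> nat" and \<theta> :: "nat \<Rightarrow> real"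
    and X :: "'x set" and Y :: "'y set" and Z :: "'z set"
    and p :: "nat \<Rightarrow> 'x pmf" and W :: "nat \<Rightarrow> 'x \<Rightarrow> 'y pmf" and V :: "nat \<Rightarrow> 'x \<Rightarrow> 'z pmf"
  assumes fin: "finite X" "finite Y" "finite Z"
    and p: "\<And>t. t \<in> {1..T} \<Longrightarrow> set_pmf (p t) \<subseteq> X"
    and V: "\<And>s x. x \<in> X \<Longrightarrow> set_pmf (V s x) \<subseteq> Z"
    and L: "\<And>t. t \<in> {1..T} \<Longrightarrow> 1 \<le> L t"
    and \<theta>: "\<And>t. t \<in> {1..T} \<Longrightarrow> 0 < \<theta> t"
begin

definition hit :: "nat \<Rightarrow> 'x \<Rightarrow> 'y \<Rightarrow> bool" where
  "hit t x y \<longleftrightarrow> \<theta> t * pmf (bind_pmf (p t) (W t)) y < pmf (W t x) y"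

definition indices :: "nat set \<Rightarrow> (nat \<times> nat \<times> nat) set" where
  "indices M = (SIGMA t:{1..T}. M \<times> {1..L t})"

definition hit_set :: "(nat \<times> nat \<times> nat \<Rightarrow> 'x) \<Rightarrow> nat set \<Rightarrow> 'y set" where
  "hit_set c M = (\<Union>i\<in>indices M. {y\<in>Y. hit (fst i) (c i) y})"

text \<open>Removing what any other message hits makes the sets disjoint by construction. Codewords
  of the same message for other states or other randomization indices do not compete with each
  other.\<close>

definition dec :: "(nat \<times> nat \<times> nat \<Rightarrow> 'x) \<Rightarrow> nat \<Rightarrow> 'y set" where
  "dec c k = hit_set c {k} - hit_set c ({1..K} - {k})"

definition enc :: "(nat \<times> nat \<times> nat \<Rightarrow> 'x) \<Rightarrow> nat \<Rightarrow> nat \<Rightarrow> 'x pmf" where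
  "enc c t k = encoder (\<lambda>l. c (t, k, l)) (L t)"

definition err :: "(nat \<times> nat \<times> nat \<Rightarrow> 'x) \<Rightarrow> nat \<Rightarrow> nat \<Rightarrow> real" where
  "err c t k = measure_pmf.expectation (enc c t k) (\<lambda>x. measure_pmf.prob (W t x) (Y - dec c k))"

definition leak :: "(nat \<times> nat \<times> nat \<Rightarrow> 'x) \<Rightarrow> nat \<Rightarrow> nat \<Rightarrow> nat \<Rightarrow> real" where
  "leak c t s k = divergence Z (bind_pmf (enc c t k) (V s)) (bind_pmf (p t) (V s))"

definition miss_prob :: "nat \<Rightarrow> real" where
  "miss_prob t = (\<Sum>x\<in>X. pmf (p t) x * measure_pmf.prob (W t x)
    {y\<in>Y. pmf (W t x) y \<le> \<theta> t * pmf (bind_pmf (p t) (W t)) y})"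

text \<open>The union bound over the codewords of all states, each passing the test wrongly with
  probability at most \<open>1 / \<theta> t\<close>. The true message is counted as well, which only
  enlarges the bound.\<close>

definition confusion :: real where
  "confusion = (\<Sum>t\<in>{1..T}. real K * real (L t) / \<theta> t)"

text \<open>The soft-covering bound on the expected divergence: inside the logarithm stands the
  contribution of one codeword plus 1 for all the others together.\<close>

definition resolution :: "nat \<Rightarrow> nat \<Rightarrow> real" where
  "resolution t s = (\<Sum>x\<in>X. \<Sum>z\<in>Z. pmf (p t) x * pmf (V s x) z *
    log 2 (1 + pmf (V s x) z / (real (L t) * pmf (bind_pmf (p t) (V s)) z)))"

definition codebook :: "(nat \<times> nat \<times> nat \<Rightarrow> 'x) pmf" where
  "codebook = Pi_pmf (indices {1..K}) undefined (\<lambda>i. p (fst i))"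

section \<open>Expectations over the random codebook\<close>

lemma finite_indices: "finite M \<Longrightarrow> finite (indices M)"
  by (auto simp: indices_def)

lemma set_codebook:
  assumes "c \<in> set_pmf codebook" "t \<in> {1..T}" "k \<in> {1..K}" "l \<in> {1..L t}"
  shows "c (t, k, l) \<in> set_pmf (p t)"
proof -
  have "c \<in> PiE_dflt (indices {1..K}) undefined (set_pmf \<circ> (\<lambda>i. p (fst i)))"
    using assms(1) set_Pi_pmf_subset'[of "indices {1..K}" undefined "\<lambda>i. p (fst i)"] finite_indices[of "{1..K}"]
    unfolding codebook_def by blast
  moreover have "(t, k, l) \<in> indices {1..K}"
    using assms by (simp add: indices_def)
  ultimately show ?thesis
    by (force simp: PiE_dflt_def)
qed

lemma finite_codebook: "finite (set_pmf codebook)"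
proof (rule finite_subset)
  show "set_pmf codebook \<subseteq> PiE_dflt (indices {1..K}) undefined (set_pmf \<circ> (\<lambda>i. p (fst i)))"
    unfolding codebook_def by (intro set_Pi_pmf_subset' finite_indices) simp
  show "finite (PiE_dflt (indices {1..K}) undefined (set_pmf \<circ> (\<lambda>i. p (fst i))))"
  proof (intro finite_PiE_dflt finite_indices)
    fix i assume "i \<in> indices {1..K}"
    then have "fst i \<in> {1..T}"
      by (auto simp: indices_def)
    then show "finite ((set_pmf \<circ> (\<lambda>i. p (fst i))) i)"
      using p fin(1) by (auto intro: finite_subset)
  qed simp
qed

lemma integrable_codebook: "integrable (measure_pmf codebook) (f :: _ \<Rightarrow> real)"
  by (rule integrable_measure_pmf_finite[OF finite_codebook])

lemma expectation_codebook_mono: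
  fixes f g :: "_ \<Rightarrow> real"
  assumes "\<And>c. c \<in> set_pmf codebook \<Longrightarrow> f c \<le> g c"
  shows "measure_pmf.expectation codebook f \<le> measure_pmf.expectation codebook g"
  using assms by (intro integral_mono_AE integrable_codebook) (auto simp: AE_measure_pmf_iff)

lemma expectation_codebook_component:
  fixes f :: "'x \<Rightarrow> real"
  assumes "t \<in> {1..T}" "k \<in> {1..K}" "l \<in> {1..L t}"
  shows "measure_pmf.expectation codebook (\<lambda>c. f (c (t, k, l))) = (\<Sum>x\<in>X. pmf (p t) x * f x)"
  unfolding codebook_def
  by (subst expectation_Pi_pmf_component[where X = X])
    (use assms p fin finite_indices in \<open>auto simp: indices_def\<close>)

lemma expectation_codebook_pair:
  fixes f :: "'x \<Rightarrow> 'x \<Rightarrow> real"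
  assumes "(t, k, l) \<in> indices {1..K}" "(t', k', l') \<in> indices {1..K}" "(t, k, l) \<noteq> (t', k', l')"
  shows "measure_pmf.expectation codebook (\<lambda>c. f (c (t, k, l)) (c (t', k', l'))) =
    (\<Sum>x\<in>X. pmf (p t) x * (\<Sum>x'\<in>X. pmf (p t') x' * f x x'))"
  unfolding codebook_def
  by (subst expectation_Pi_pmf_pair[where X = X])
    (use assms p fin finite_indices in \<open>auto simp: indices_def\<close>)

lemma err_eq:
  assumes "t \<in> {1..T}"
  shows "err c t k = (\<Sum>l\<in>{1..L t}. measure_pmf.prob (W t (c (t, k, l))) (Y - dec c k)) / real (L t)"
  unfolding err_def enc_def using L[OF assms] by (rule expectation_encoder)

lemma prob_error_le:
  assumes "t \<in> {1..T}" "l \<in> {1..L t}"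
  shows "measure_pmf.prob (W t (c (t, k, l))) (Y - dec c k) \<le>
    measure_pmf.prob (W t (c (t, k, l))) {y\<in>Y. \<not> hit t (c (t, k, l)) y} +
    (\<Sum>i\<in>indices ({1..K} - {k}). measure_pmf.prob (W t (c (t, k, l))) {y\<in>Y. hit (fst i) (c i) y})"
proof -
  let ?M = "measure_pmf (W t (c (t, k, l)))"
  have "Y - dec c k \<subseteq> {y\<in>Y. \<not> hit t (c (t, k, l)) y} \<union> hit_set c ({1..K} - {k})"
    using assms unfolding dec_def hit_set_def indices_def by force
  then have "measure ?M (Y - dec c k) \<le> measure ?M ({y\<in>Y. \<not> hit t (c (t, k, l)) y} \<union> hit_set c ({1..K} - {k}))"
    by (intro measure_pmf.finite_measure_mono) auto
  also have "\<dots> \<le> measure ?M {y\<in>Y. \<not> hit t (c (t, k, l)) y} + measure ?M (hit_set c ({1..K} - {k}))"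
    by (rule measure_Un_le) auto
  also have "measure ?M (hit_set c ({1..K} - {k})) \<le>
      (\<Sum>i\<in>indices ({1..K} - {k}). measure ?M {y\<in>Y. hit (fst i) (c i) y})"
    unfolding hit_set_def by (intro measure_UNION_le finite_indices) auto
  finally show ?thesis
    by simp
qed

text \<open>The output is generated by the codeword at \<open>(t, k, l)\<close> and is thus
  independent of the codeword at \<open>i\<close>, so \<open>threshold_hit_bound\<close> applies
  conditionally on each output. The state of \<open>i\<close> may differ from \<open>t\<close>,
  which is what allows decoding without knowing \<open>t\<close>.\<close>

lemma expected_hit_le:
  assumes "(t, k, l) \<in> indices {1..K}" "i \<in> indices {1..K}" "(t, k, l) \<noteq> i"
  shows "measure_pmf.expectation codebook
    (\<lambda>c. measure_pmf.prob (W t (c (t, k, l))) {y\<in>Y. hit (fst i) (c i) y}) \<le> 1 / \<theta> (fst i)"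
proof -
  obtain t' k' l' where i: "i = (t', k', l')"
    by (cases i)
  have t: "t \<in> {1..T}" and t': "t' \<in> {1..T}"
    using assms by (auto simp: indices_def i)
  have prob: "measure_pmf.prob (W t x) {y\<in>Y. hit t' x' y} = (\<Sum>y\<in>Y. pmf (W t x) y * of_bool (hit t' x' y))" for x x'
    using fin by (simp add: measure_measure_pmf_finite of_bool_def if_distrib sum.inter_filter cong: if_cong)
  have "measure_pmf.expectation codebook (\<lambda>c. measure_pmf.prob (W t (c (t, k, l))) {y\<in>Y. hit (fst i) (c i) y}) =
      (\<Sum>x\<in>X. pmf (p t) x * (\<Sum>x'\<in>X. pmf (p t') x' * measure_pmf.prob (W t x) {y\<in>Y. hit t' x' y}))"
    unfolding i fst_conv by (rule expectation_codebook_pair) (use assms in \<open>auto simp: i\<close>)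
  also have "\<dots> \<le> (\<Sum>x\<in>X. pmf (p t) x * (1 / \<theta> t'))"
  proof (intro sum_mono mult_left_mono)
    fix x
    have "(\<Sum>x'\<in>X. pmf (p t') x' * measure_pmf.prob (W t x) {y\<in>Y. hit t' x' y}) =
        (\<Sum>y\<in>Y. pmf (W t x) y * (\<Sum>x'\<in>X. pmf (p t') x' * of_bool (hit t' x' y)))"
      unfolding prob sum_distrib_left by (subst sum.swap) (simp add: mult_ac)
    also have "\<dots> \<le> (\<Sum>y\<in>Y. pmf (W t x) y * (1 / \<theta> t'))"
      unfolding hit_def using fin p[OF t'] \<theta>[OF t']
      by (intro sum_mono mult_left_mono threshold_hit_bound) auto
    also have "\<dots> = measure_pmf.prob (W t x) Y * (1 / \<theta> t')"
      using fin by (simp add: measure_measure_pmf_finite sum_divide_distrib)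
    also have "\<dots> \<le> 1 * (1 / \<theta> t')"
      using \<theta>[OF t'] by (intro mult_right_mono) auto
    finally show "(\<Sum>x'\<in>X. pmf (p t') x' * measure_pmf.prob (W t x) {y\<in>Y. hit t' x' y}) \<le> 1 / \<theta> t'"
      by simp
  qed simp
  also have "\<dots> = 1 / \<theta> t'"
    using sum_pmf_eq_1[OF fin(1) p[OF t]] by (simp flip: sum_divide_distrib)
  finally show ?thesis
    by (simp add: i)
qed

lemma expected_err_le:
  assumes t: "t \<in> {1..T}" and k: "k \<in> {1..K}"
  shows "measure_pmf.expectation codebook (\<lambda>c. err c t k) \<le> miss_prob t + confusion"
proof -
  let ?E = "measure_pmf.expectation codebook"
  have Lpos: "0 < real (L t)"
    using L[OF t] by simp
  have each: "?E (\<lambda>c. measure_pmf.prob (W t (c (t, k, l))) (Y - dec c k)) \<le> miss_prob t + confusion"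
    if l: "l \<in> {1..L t}" for l
  proof -
    have "?E (\<lambda>c. measure_pmf.prob (W t (c (t, k, l))) (Y - dec c k)) \<le>
        ?E (\<lambda>c. measure_pmf.prob (W t (c (t, k, l))) {y\<in>Y. \<not> hit t (c (t, k, l)) y} +
          (\<Sum>i\<in>indices ({1..K} - {k}). measure_pmf.prob (W t (c (t, k, l))) {y\<in>Y. hit (fst i) (c i) y}))"
      by (intro expectation_codebook_mono prob_error_le t l)
    also have "\<dots> = ?E (\<lambda>c. measure_pmf.prob (W t (c (t, k, l))) {y\<in>Y. \<not> hit t (c (t, k, l)) y}) +
        (\<Sum>i\<in>indices ({1..K} - {k}). ?E (\<lambda>c. measure_pmf.prob (W t (c (t, k, l))) {y\<in>Y. hit (fst i) (c i) y}))"
      by (simp add: integrable_codebook)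
    also have "?E (\<lambda>c. measure_pmf.prob (W t (c (t, k, l))) {y\<in>Y. \<not> hit t (c (t, k, l)) y}) = miss_prob t"
      unfolding miss_prob_def
      by (subst expectation_codebook_component[OF t k l]) (simp add: hit_def not_less)
    also have "(\<Sum>i\<in>indices ({1..K} - {k}). ?E (\<lambda>c. measure_pmf.prob (W t (c (t, k, l))) {y\<in>Y. hit (fst i) (c i) y}))
        \<le> (\<Sum>i\<in>indices ({1..K} - {k}). 1 / \<theta> (fst i))"
      using t k l by (intro sum_mono expected_hit_le) (auto simp: indices_def)
    also have "\<dots> \<le> (\<Sum>i\<in>indices {1..K}. 1 / \<theta> (fst i))"
      using \<theta> by (intro sum_mono2 finite_indices) (auto simp: indices_def order_less_imp_le)
    also have "\<dots> = confusion"
      unfolding indices_def confusion_def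
      by (subst sum.Sigma[symmetric, where B = "\<lambda>t. {1..K} \<times> {1..L t}" and g = "\<lambda>t _. 1 / \<theta> t", simplified case_prod_beta'])
        auto
    finally show ?thesis
      by simp
  qed
  have "?E (\<lambda>c. err c t k) = (\<Sum>l\<in>{1..L t}. ?E (\<lambda>c. measure_pmf.prob (W t (c (t, k, l))) (Y - dec c k))) / real (L t)"
    by (simp add: err_eq[OF t] integrable_codebook)
  also have "\<dots> \<le> (\<Sum>l\<in>{1..L t}. miss_prob t + confusion) / real (L t)"
    by (intro divide_right_mono sum_mono each) auto
  finally show ?thesis
    using Lpos by simp
qed

text \<open>Distinct codewords are independent, so each cross term factors. Averaging over the
  second codeword turns \<open>V s\<close> into the output distribution and leaves at most
  \<open>1 / L t\<close>, with equality unless the output has zero mass. The fewer than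
  \<open>L t\<close> cross terms are thus cancelled by the subtracted 1, and only the logarithmic
  term survives.\<close>

lemma expected_leak_le:
  assumes t: "t \<in> {1..T}" and k: "k \<in> {1..K}"
  shows "measure_pmf.expectation codebook (\<lambda>c. leak c t s k) \<le> resolution t s"
proof -
  let ?E = "measure_pmf.expectation codebook"
  let ?q = "bind_pmf (p t) (V s)"
  define u where "u x z = 1 + pmf (V s x) z / (real (L t) * pmf ?q z)" for x z
  define g where "g x z = pmf (V s x) z / u x z / ln 2" for x z
  have Lpos: "0 < real (L t)"
    using L[OF t] by simp
  have g_nonneg: "0 \<le> g x z" for x z
    by (auto simp: g_def u_def intro!: divide_nonneg_nonneg add_nonneg_nonneg)
  have Eg_nonneg: "0 \<le> (\<Sum>x\<in>X. pmf (p t) x * g x z)" for z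
    by (intro sum_nonneg mult_nonneg_nonneg g_nonneg) auto
  have q: "pmf ?q z = (\<Sum>x\<in>X. pmf (p t) x * pmf (V s x) z)" for z
    by (rule pmf_bind_finite[OF fin(1) p[OF t]])
  have "?E (\<lambda>c. leak c t s k) \<le> ?E (\<lambda>c. (\<Sum>l\<in>{1..L t}. \<Sum>z\<in>Z. pmf (V s (c (t, k, l))) z * log 2 (u (c (t, k, l)) z) +
      g (c (t, k, l)) z * ((\<Sum>l'\<in>{1..L t} - {l}. pmf (V s (c (t, k, l'))) z / (real (L t) * pmf ?q z)) - 1)) / real (L t))"
  proof (rule expectation_codebook_mono)
    fix c assume c: "c \<in> set_pmf codebook"
    have "set_pmf (V s (c (t, k, l))) \<subseteq> set_pmf ?q" if "l \<in> {1..L t}" for l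
      using set_codebook[OF c t k that] by auto
    then show "leak c t s k \<le> (\<Sum>l\<in>{1..L t}. \<Sum>z\<in>Z. pmf (V s (c (t, k, l))) z * log 2 (u (c (t, k, l)) z) +
      g (c (t, k, l)) z * ((\<Sum>l'\<in>{1..L t} - {l}. pmf (V s (c (t, k, l'))) z / (real (L t) * pmf ?q z)) - 1)) / real (L t)"
      unfolding leak_def enc_def g_def u_def
      by (intro divergence_encoder_le[OF L[OF t] fin(3)])
  qed
  also have "\<dots> = (\<Sum>l\<in>{1..L t}. \<Sum>z\<in>Z. ?E (\<lambda>c. pmf (V s (c (t, k, l))) z * log 2 (u (c (t, k, l)) z)) +
      ((\<Sum>l'\<in>{1..L t} - {l}. ?E (\<lambda>c. g (c (t, k, l)) z * (pmf (V s (c (t, k, l'))) z / (real (L t) * pmf ?q z))))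
        - ?E (\<lambda>c. g (c (t, k, l)) z))) / real (L t)"
    by (simp add: integrable_codebook right_diff_distrib sum_distrib_left)
  also have "\<dots> \<le> (\<Sum>l\<in>{1..L t}. \<Sum>z\<in>Z. \<Sum>x\<in>X. pmf (p t) x * (pmf (V s x) z * log 2 (u x z))) / real (L t)"
  proof (intro divide_right_mono sum_mono)
    fix l z assume l: "l \<in> {1..L t}"
    let ?G = "\<Sum>x\<in>X. pmf (p t) x * g x z"
    have "(\<Sum>l'\<in>{1..L t} - {l}. ?E (\<lambda>c. g (c (t, k, l)) z * (pmf (V s (c (t, k, l'))) z / (real (L t) * pmf ?q z))))
        \<le> (\<Sum>l'\<in>{1..L t} - {l}. ?G / real (L t))"
    proof (rule sum_mono)
      fix l' assume l': "l' \<in> {1..L t} - {l}"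
      have "?E (\<lambda>c. g (c (t, k, l)) z * (pmf (V s (c (t, k, l'))) z / (real (L t) * pmf ?q z))) =
          (\<Sum>x\<in>X. pmf (p t) x * (\<Sum>x'\<in>X. pmf (p t) x' * (g x z * (pmf (V s x') z / (real (L t) * pmf ?q z)))))"
        by (rule expectation_codebook_pair) (use t k l l' in \<open>auto simp: indices_def\<close>)
      also have "\<dots> = ?G * (pmf ?q z / (real (L t) * pmf ?q z))"
      proof -
        have "(\<Sum>x'\<in>X. pmf (p t) x' * (g x z * (pmf (V s x') z / (real (L t) * pmf ?q z)))) =
            g x z * (pmf ?q z / (real (L t) * pmf ?q z))" for x
          unfolding q[of z] sum_divide_distrib sum_distrib_left by (simp add: mult_ac)
        then show ?thesis
          by (simp add: sum_distrib_right mult.assoc)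
      qed
      also have "\<dots> \<le> ?G * (1 / real (L t))"
        using Lpos by (intro mult_left_mono Eg_nonneg) auto
      finally show "?E (\<lambda>c. g (c (t, k, l)) z * (pmf (V s (c (t, k, l'))) z / (real (L t) * pmf ?q z))) \<le> ?G / real (L t)"
        by simp
    qed
    also have "\<dots> = real (card ({1..L t} - {l})) * (?G / real (L t))"
      by simp
    also have "\<dots> \<le> real (L t) * (?G / real (L t))"
      using l Eg_nonneg by (intro mult_right_mono) auto
    also have "\<dots> = ?G"
      using Lpos by simp
    also have "\<dots> = ?E (\<lambda>c. g (c (t, k, l)) z)"
      by (rule expectation_codebook_component[OF t k l, symmetric])
    finally show "?E (\<lambda>c. pmf (V s (c (t, k, l))) z * log 2 (u (c (t, k, l)) z)) +
      ((\<Sum>l'\<in>{1..L t} - {l}. ?E (\<lambda>c. g (c (t, k, l)) z * (pmf (V s (c (t, k, l'))) z / (real (L t) * pmf ?q z))))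
        - ?E (\<lambda>c. g (c (t, k, l)) z)) \<le> (\<Sum>x\<in>X. pmf (p t) x * (pmf (V s x) z * log 2 (u x z)))"
      using expectation_codebook_component[OF t k l, of "\<lambda>x. pmf (V s x) z * log 2 (u x z)"] by simp
  qed simp
  also have "\<dots> = (\<Sum>z\<in>Z. \<Sum>x\<in>X. pmf (p t) x * (pmf (V s x) z * log 2 (u x z)))"
    using Lpos by simp
  also have "\<dots> = resolution t s"
    unfolding resolution_def u_def by (subst sum.swap) (simp add: mult.assoc)
  finally show ?thesis .
qed

section \<open>Selection of a good code\<close>

lemma disjoint_dec: "disjoint_family_on (dec c) {1..K}"
  unfolding disjoint_family_on_def
proof (intro ballI impI)
  fix k k' assume "k \<in> {1..K}" "k' \<in> {1..K}" "k \<noteq> k'"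
  then have "indices {k} \<subseteq> indices ({1..K} - {k'})"
    by (auto simp: indices_def)
  then have "hit_set c {k} \<subseteq> hit_set c ({1..K} - {k'})"
    unfolding hit_set_def by (rule UN_mono) simp
  then show "dec c k \<inter> dec c k' = {}"
    unfolding dec_def by blast
qed

lemma dec_subset: "dec c k \<subseteq> Y"
  by (auto simp: dec_def hit_set_def)

lemma err_nonneg: "0 \<le> err c t k"
  unfolding err_def by (intro integral_nonneg_AE) simp

lemma set_enc_subset:
  assumes "c \<in> set_pmf codebook" "t \<in> {1..T}" "k \<in> {1..K}"
  shows "set_pmf (enc c t k) \<subseteq> set_pmf (p t)"
  using set_codebook[OF assms] L[OF assms(2)] by (auto simp: enc_def set_pmf_encoder)

lemma leak_nonneg:
  assumes c: "c \<in> set_pmf codebook" and t: "t \<in> {1..T}" and k: "k \<in> {1..K}"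
  shows "0 \<le> leak c t s k"
  unfolding leak_def
proof (rule divergence_nonneg)
  show "set_pmf (bind_pmf (enc c t k) (V s)) \<subseteq> Z"
    using set_enc_subset[OF assms] p[OF t] V unfolding set_bind_pmf by blast
  show "set_pmf (bind_pmf (enc c t k) (V s)) \<subseteq> set_pmf (bind_pmf (p t) (V s))"
    using set_enc_subset[OF assms] unfolding set_bind_pmf by blast
qed (rule fin)

text \<open>A bound on the expected cost per message, summed over all states. All costs are
  nonnegative on the support of \<open>codebook\<close>, so a bound on the sum controls each error
  and each leakage at once.\<close>

definition mean_cost :: real where
  "mean_cost = (\<Sum>t\<in>{1..T}. miss_prob t + confusion + (\<Sum>s\<in>{1..S}. resolution t s))"

text \<open>Expurgation: at least half of the \<open>2 J\<close> messages have at most twice the average cost.\<close>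

lemma exists_good_code:
  assumes K: "K = 2 * J"
  shows "\<exists>E D. (\<forall>t\<in>{1..T}. \<forall>j\<in>{1..J}. set_pmf (E t j) \<subseteq> set_pmf (p t)) \<and>
    (\<forall>j\<in>{1..J}. D j \<subseteq> Y) \<and> disjoint_family_on D {1..J} \<and>
    (\<forall>t\<in>{1..T}. \<forall>j\<in>{1..J}.
      measure_pmf.expectation (E t j) (\<lambda>x. measure_pmf.prob (W t x) (Y - D j)) \<le> 2 * mean_cost) \<and>
    (\<forall>t\<in>{1..T}. \<forall>s\<in>{1..S}. \<forall>j\<in>{1..J}.
      divergence Z (bind_pmf (E t j) (V s)) (bind_pmf (p t) (V s)) \<le> 2 * mean_cost)"
proof -
  define cost where "cost c k = (\<Sum>t\<in>{1..T}. err c t k + (\<Sum>s\<in>{1..S}. leak c t s k))" for c k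
  have "measure_pmf.expectation codebook (\<lambda>c. \<Sum>k\<in>{1..K}. cost c k) =
      (\<Sum>k\<in>{1..K}. \<Sum>t\<in>{1..T}. measure_pmf.expectation codebook (\<lambda>c. err c t k) +
        (\<Sum>s\<in>{1..S}. measure_pmf.expectation codebook (\<lambda>c. leak c t s k)))"
    unfolding cost_def by (simp add: integrable_codebook)
  also have "\<dots> \<le> (\<Sum>k\<in>{1..K}. mean_cost)"
    unfolding mean_cost_def by (intro sum_mono add_mono expected_err_le expected_leak_le)
  also have "\<dots> = 2 * real J * mean_cost"
    by (simp add: K)
  finally obtain c where c: "c \<in> set_pmf codebook" and cost: "(\<Sum>k\<in>{1..K}. cost c k) \<le> 2 * real J * mean_cost"
    using pmf_exists_le_expectation[OF finite_codebook] by blast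
  have cost_nonneg: "0 \<le> cost c k" if "k \<in> {1..K}" for k
    unfolding cost_def by (intro sum_nonneg add_nonneg_nonneg err_nonneg leak_nonneg c that)
  define G where "G = {k\<in>{1..K}. cost c k \<le> 2 * mean_cost}"
  \<comment> \<open>Markov's inequality by counting: otherwise more than \<open>J\<close> messages
    would each cost more than \<open>2 * mean_cost\<close>, exceeding the total.\<close>
  have "J \<le> card G"
  proof (rule ccontr)
    assume "\<not> J \<le> card G"
    moreover have "card ({1..K} - G) = K - card G"
      by (subst card_Diff_subset) (auto simp: G_def)
    ultimately have bad: "J < card ({1..K} - G)"
      using K by linarith
    have "2 * real J * mean_cost < (\<Sum>k\<in>{1..K} - G. cost c k)"
    proof -
      have "0 \<le> (\<Sum>k\<in>{1..K}. cost c k)"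
        by (intro sum_nonneg cost_nonneg)
      then have "0 \<le> 2 * real J * mean_cost"
        using cost by linarith
      then have "0 \<le> mean_cost" if "0 < J"
        using that by (simp add: zero_le_mult_iff)
      then have "2 * real J * mean_cost \<le> real (card ({1..K} - G)) * (2 * mean_cost)"
        using bad by (cases "J = 0") (auto intro!: mult_right_mono simp: K)
      also have "\<dots> = (\<Sum>k\<in>{1..K} - G. 2 * mean_cost)"
        by simp
      also have "\<dots> < (\<Sum>k\<in>{1..K} - G. cost c k)"
      proof (rule sum_strict_mono)
        show "{1..K} - G \<noteq> {}"
          using bad by (metis card.empty not_less0)
      qed (auto simp: G_def)
      finally show ?thesis .
    qed
    also have "\<dots> \<le> (\<Sum>k\<in>{1..K}. cost c k)"
      by (intro sum_mono2 cost_nonneg) auto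
    finally show False
      using cost by simp
  qed
  \<comment> \<open>\<open>\<kappa>\<close> renumbers good messages. Their decoding sets still
    exclude the hits of discarded messages, so the error bounds and disjointness carry over
    unchanged.\<close>
  then obtain \<kappa> where \<kappa>: "inj_on \<kappa> {1..J}" "\<kappa> ` {1..J} \<subseteq> G"
    using card_le_inj[of "{1..J}" G] by (auto simp: G_def)
  have \<kappa>K: "\<kappa> j \<in> {1..K}" and \<kappa>_cost: "cost c (\<kappa> j) \<le> 2 * mean_cost" if "j \<in> {1..J}" for j
    using subsetD[OF \<kappa>(2) imageI[OF that]] by (simp_all add: G_def)
  have err_cost: "err c t k \<le> cost c k" and leak_cost: "s \<in> {1..S} \<Longrightarrow> leak c t s k \<le> cost c k"
    if "t \<in> {1..T}" "k \<in> {1..K}" for t s k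
  proof -
    have "err c t k + (\<Sum>s\<in>{1..S}. leak c t s k) \<le> cost c k"
      unfolding cost_def using that c
      by (intro member_le_sum) (auto intro!: sum_nonneg add_nonneg_nonneg err_nonneg leak_nonneg)
    moreover have "0 \<le> (\<Sum>s\<in>{1..S}. leak c t s k)"
      using that c by (intro sum_nonneg leak_nonneg)
    moreover have "leak c t s k \<le> (\<Sum>s\<in>{1..S}. leak c t s k)" if "s \<in> {1..S}" for s
      using that \<open>t \<in> {1..T}\<close> \<open>k \<in> {1..K}\<close> c by (intro member_le_sum leak_nonneg) auto
    ultimately show "err c t k \<le> cost c k" "s \<in> {1..S} \<Longrightarrow> leak c t s k \<le> cost c k"
      using err_nonneg[of c t k] by fastforce+
  qed
  show ?thesis
  proof (intro exI conjI ballI)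
    show "set_pmf (enc c t (\<kappa> j)) \<subseteq> set_pmf (p t)" if "t \<in> {1..T}" "j \<in> {1..J}" for t j
      using that by (intro set_enc_subset c \<kappa>K)
    show "dec c (\<kappa> j) \<subseteq> Y" for j
      by (rule dec_subset)
    show "disjoint_family_on (\<lambda>j. dec c (\<kappa> j)) {1..J}"
      unfolding disjoint_family_on_def
    proof (intro ballI impI)
      fix i j assume "i \<in> {1..J}" "j \<in> {1..J}" "i \<noteq> j"
      then show "dec c (\<kappa> i) \<inter> dec c (\<kappa> j) = {}"
        using \<kappa>(1) \<kappa>K by (intro disjoint_family_onD[OF disjoint_dec]) (auto dest: inj_onD)
    qed
    show "measure_pmf.expectation (enc c t (\<kappa> j)) (\<lambda>x. measure_pmf.prob (W t x) (Y - dec c (\<kappa> j))) \<le> 2 * mean_cost"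
      if "t \<in> {1..T}" "j \<in> {1..J}" for t j
      using err_cost[OF that(1) \<kappa>K[OF that(2)]] \<kappa>_cost[OF that(2)] by (simp add: err_def)
    show "divergence Z (bind_pmf (enc c t (\<kappa> j)) (V s)) (bind_pmf (p t) (V s)) \<le> 2 * mean_cost"
      if "t \<in> {1..T}" "s \<in> {1..S}" "j \<in> {1..J}" for t s j
      using leak_cost[OF that(1) \<kappa>K[OF that(3)] that(2)] \<kappa>_cost[OF that(3)] by (simp add: leak_def)
  qed
qed

end

section \<open>Achievable rates\<close>

lemma set_pmf_uniform_message: "1 \<le> J \<Longrightarrow> set_pmf (pmf_of_set {1..J}) = {1..J::nat}"
  by simp

lemma set_pmf_output_words:
  assumes "set_pmf P \<subseteq> words n"
  shows "set_pmf (bind_pmf P (memoryless_ext V)) \<subseteq> words n"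
  unfolding set_bind_pmf
proof (rule UN_least)
  fix xs assume "xs \<in> set_pmf P"
  then have "xs \<in> words n"
    using assms by (rule rev_subsetD)
  then show "set_pmf (memoryless_ext V xs) \<subseteq> words n"
    by (rule set_pmf_memoryless_ext_words)
qed

text \<open>The asymptotic definition is reduced to one existence statement per block length. The
  reference \<open>Q n t s\<close> is the same for all messages, so a divergence bound for every
  message bounds the mutual information with a uniform message.\<close>

lemma achievable_CSI_tI:
  fixes W :: "nat \<Rightarrow> 'a::finite \<Rightarrow> 'b::finite pmf" and V :: "nat \<Rightarrow> 'a \<Rightarrow> 'c::finite pmf"
  assumes T: "1 \<le> T" and S: "1 \<le> S" and R: "0 \<le> R" and e: "e \<longlonglongrightarrow> 0"
    and codes: "\<And>n. \<exists>J E D. 2 powr (real n * R) \<le> real J \<and> is_code T n J E D \<and>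
      (\<forall>t\<in>{1..T}. \<forall>j\<in>{1..J}. (\<Sum>xs\<in>words n. pmf (E t j) xs *
          measure_pmf.prob (memoryless_ext (W t) xs) (words n - D j)) \<le> e n) \<and>
      (\<forall>t\<in>{1..T}. \<forall>s\<in>{1..S}. \<forall>j\<in>{1..J}. divergence (words n)
          (bind_pmf (E t j) (memoryless_ext (V s))) (Q n t s) \<le> e n \<and>
          set_pmf (bind_pmf (E t j) (memoryless_ext (V s))) \<subseteq> set_pmf (Q n t s))"
  shows "achievable_CSI_t T S W V R"
proof -
  define good where "good n J E D \<longleftrightarrow> 2 powr (real n * R) \<le> real J \<and> is_code T n J E D \<and>
      (\<forall>t\<in>{1..T}. \<forall>j\<in>{1..J}. (\<Sum>xs\<in>words n. pmf (E t j) xs *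
          measure_pmf.prob (memoryless_ext (W t) xs) (words n - D j)) \<le> e n) \<and>
      (\<forall>t\<in>{1..T}. \<forall>s\<in>{1..S}. \<forall>j\<in>{1..J}. divergence (words n)
          (bind_pmf (E t j) (memoryless_ext (V s))) (Q n t s) \<le> e n \<and>
          set_pmf (bind_pmf (E t j) (memoryless_ext (V s))) \<subseteq> set_pmf (Q n t s))" for n J E D
  have "\<forall>n. \<exists>J E D. good n J E D"
    using codes unfolding good_def by blast
  then obtain J E D where good: "\<And>n. good n (J n) (E n) (D n)"
    by metis
  have J: "\<And>n. 2 powr (real n * R) \<le> real (J n)"
    and code: "\<And>n. is_code T n (J n) (E n) (D n)"
    and err: "\<And>n t j. t \<in> {1..T} \<Longrightarrow> j \<in> {1..J n} \<Longrightarrow> (\<Sum>xs\<in>words n. pmf (E n t j) xs *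
          measure_pmf.prob (memoryless_ext (W t) xs) (words n - D n j)) \<le> e n"
    and leak: "\<And>n t s j. t \<in> {1..T} \<Longrightarrow> s \<in> {1..S} \<Longrightarrow> j \<in> {1..J n} \<Longrightarrow> divergence (words n)
          (bind_pmf (E n t j) (memoryless_ext (V s))) (Q n t s) \<le> e n"
    and supp: "\<And>n t s j. t \<in> {1..T} \<Longrightarrow> s \<in> {1..S} \<Longrightarrow> j \<in> {1..J n} \<Longrightarrow>
          set_pmf (bind_pmf (E n t j) (memoryless_ext (V s))) \<subseteq> set_pmf (Q n t s)"
    using good unfolding good_def by blast+
  have J1: "1 \<le> J n" for n
    using code[of n] by (simp add: is_code_def)
  have E: "set_pmf (E n t j) \<subseteq> words n" if "t \<in> {1..T}" "j \<in> {1..J n}" for n t j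
    using code[of n] that by (auto simp: is_code_def)
  have "0 \<le> max_error T W n (J n) (E n) (D n) \<and> max_error T W n (J n) (E n) (D n) \<le> e n" for n
  proof -
    let ?f = "\<lambda>t j. \<Sum>xs\<in>words n. pmf (E n t j) xs *
        measure_pmf.prob (memoryless_ext (W t) xs) (words n - D n j)"
    have f: "0 \<le> ?f t j" for t j
      by (intro sum_nonneg mult_nonneg_nonneg) auto
    have inner: "0 \<le> (MAX j\<in>{1..J n}. ?f t j)" "t \<in> {1..T} \<Longrightarrow> (MAX j\<in>{1..J n}. ?f t j) \<le> e n" for t
      using J1[of n] f err by (subst Max_ge_iff Max_le_iff; fastforce)+
    then show ?thesis
      unfolding max_error_def using T by (subst Max_ge_iff Max_le_iff; fastforce)+
  qed
  then have lim_err: "(\<lambda>n. max_error T W n (J n) (E n) (D n)) \<longlonglongrightarrow> 0"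
    by (intro tendsto_sandwich[OF _ _ tendsto_const e]) auto
  have "0 \<le> max_leakage T S V (J n) (E n) \<and> max_leakage T S V (J n) (E n) \<le> e n" for n
  proof -
    let ?f = "\<lambda>t s. mutual_info (pmf_of_set {1..J n}) (\<lambda>j. bind_pmf (E n t j) (memoryless_ext (V s)))"
    have f: "0 \<le> ?f t s \<and> ?f t s \<le> e n" if t: "t \<in> {1..T}" and s: "s \<in> {1..S}" for t s
    proof
      note b = set_pmf_uniform_message[OF J1[of n]] set_pmf_output_words[OF E[OF t]]
      show "0 \<le> ?f t s"
        by (rule mutual_info_nonneg[of "{1..J n}" _ "words n"]) (simp_all only: b finite_words finite_atLeastAtMost order_refl)
      have "?f t s \<le> (\<Sum>j\<in>{1..J n}. pmf (pmf_of_set {1..J n}) j * divergence (words n)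
          (bind_pmf (E n t j) (memoryless_ext (V s))) (Q n t s))"
        by (rule mutual_info_le_divergence) (simp_all only: b supp[OF t s] finite_words finite_atLeastAtMost order_refl)
      also have "\<dots> \<le> (\<Sum>j\<in>{1..J n}. pmf (pmf_of_set {1..J n}) j * e n)"
        by (intro sum_mono mult_left_mono leak t s) auto
      also have "\<dots> = e n"
        using J1[of n] by (simp flip: sum_distrib_right)
      finally show "?f t s \<le> e n" .
    qed
    have ne: "{1..T} \<times> {1..S} \<noteq> {}"
      using T S by auto
    have "max_leakage T S V (J n) (E n) \<in> (\<lambda>(t, s). ?f t s) ` ({1..T} \<times> {1..S})"
      unfolding max_leakage_def using ne by (intro Max_in) auto
    then show ?thesis
      using f by auto
  qed
  then have lim_leak: "(\<lambda>n. max_leakage T S V (J n) (E n)) \<longlonglongrightarrow> 0"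
    by (intro tendsto_sandwich[OF _ _ tendsto_const e]) auto
  have "R \<le> 1 / real n * log 2 (real (J n))" if "1 \<le> n" for n
  proof -
    have "real n * R = log 2 (2 powr (real n * R))"
      by simp
    also have "\<dots> \<le> log 2 (real (J n))"
      using J[of n] J1[of n] by (subst log_le_cancel_iff) auto
    finally show ?thesis
      using that by (simp add: field_simps)
  qed
  then have "ereal R \<le> liminf (\<lambda>n. ereal (1 / real n * log 2 (real (J n))))"
    by (intro Liminf_bounded eventually_sequentiallyI[of 1]) simp
  then show ?thesis
    unfolding achievable_CSI_t_def using R code lim_err lim_leak by blast
qed

text \<open>A single message sent as a fixed word is never decoded wrongly when every output word is
  accepted, and it leaks nothing. The set of achievable rates is therefore nonempty.\<close>

lemma achievable_0:
  fixes W :: "nat \<Rightarrow> 'a::finite \<Rightarrow> 'b::finite pmf" and V :: "nat \<Rightarrow> 'a \<Rightarrow> 'c::finite pmf"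
  assumes "1 \<le> T" "1 \<le> S"
  shows "achievable_CSI_t T S W V 0"
proof (rule achievable_CSI_tI[OF assms, where e = "\<lambda>_. 0"])
  fix n
  define x :: "'a list" where "x = replicate n undefined"
  have "is_code T n 1 (\<lambda>_ _. return_pmf x) (\<lambda>_. words n)"
    by (auto simp: is_code_def x_def words_def disjoint_family_on_def)
  then show "\<exists>J E D. 2 powr (real n * 0) \<le> real J \<and> is_code T n J E D \<and>
      (\<forall>t\<in>{1..T}. \<forall>j\<in>{1..J}. (\<Sum>xs\<in>words n. pmf (E t j) xs *
          measure_pmf.prob (memoryless_ext (W t) xs) (words n - D j)) \<le> 0) \<and>
      (\<forall>t\<in>{1..T}. \<forall>s\<in>{1..S}. \<forall>j\<in>{1..J}. divergence (words n)
          (bind_pmf (E t j) (memoryless_ext (V s))) (memoryless_ext (V s) x) \<le> 0 \<and>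
          set_pmf (bind_pmf (E t j) (memoryless_ext (V s))) \<subseteq> set_pmf (memoryless_ext (V s) x))"
    by (intro exI[of _ 1] exI[of _ "\<lambda>_ _. return_pmf x"] exI[of _ "\<lambda>_. words n"])
      (auto simp: bind_return_pmf divergence_def intro!: sum_nonpos)
qed auto

lemma nat_ceiling_le_double:
  assumes "1 \<le> (x::real)"
  shows "x \<le> real (nat \<lceil>x\<rceil>)" "real (nat \<lceil>x\<rceil>) \<le> 2 * x" "1 \<le> nat \<lceil>x\<rceil>"
  using assms by linarith+

lemma powr_mult_nat: "2 powr (real n * a) = (2 powr a) ^ n"
  by (metis mult.commute powr_powr powr_realpow zero_less_numeral powr_gt_zero)

text \<open>The bound \<open>v t\<close> is common to all \<open>s\<close>, so a single
  randomization rate per \<open>t\<close> covers every eavesdropper. Rates and \<open>v t\<close>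
  are nonnegative, which keeps the cost of rounding up to a factor 2.\<close>

lemma achievable_below:
  fixes W :: "nat \<Rightarrow> 'a::finite \<Rightarrow> 'b::finite pmf" and V :: "nat \<Rightarrow> 'a \<Rightarrow> 'c::finite pmf"
  assumes T: "1 \<le> T" and S: "1 \<le> S" and R: "0 \<le> R"
    and v: "\<And>t s. t \<in> {1..T} \<Longrightarrow> s \<in> {1..S} \<Longrightarrow> mutual_info (p t) (V s) \<le> v t"
      "\<And>t. t \<in> {1..T} \<Longrightarrow> 0 \<le> v t"
    and rate: "\<And>t. t \<in> {1..T} \<Longrightarrow> R + v t < mutual_info (p t) (W t)"
  shows "achievable_CSI_t T S W V R"
proof -
  define I where "I t = mutual_info (p t) (W t)" for t
  \<comment> \<open>The gap is spent as 2 + 2 + 1: two parts lower the threshold below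
    \<open>I t\<close>, two raise the randomization rate above \<open>v t\<close>, and one remains
    as the exponent of confusion. In the first two items the moment bound uses up one part and the
    other is the exponent.\<close>
  define \<delta> where "\<delta> t = (I t - v t - R) / 5" for t
  have \<delta>: "0 < \<delta> t" if "t \<in> {1..T}" for t
    using rate[OF that] by (simp add: \<delta>_def I_def)
  have "\<forall>t. \<exists>s. t \<in> {1..T} \<longrightarrow> 0 < s \<and> s \<le> 1 \<and> info_moment UNIV UNIV (p t) (W t) (- s) \<le> 2 powr (- s * (I t - \<delta> t))"
    using info_moment_bounds(2)[OF \<delta>] unfolding I_def by blast
  then obtain \<sigma> where \<sigma>: "\<And>t. t \<in> {1..T} \<Longrightarrow> 0 < \<sigma> t"
      "\<And>t. t \<in> {1..T} \<Longrightarrow> info_moment UNIV UNIV (p t) (W t) (- \<sigma> t) \<le> 2 powr (- \<sigma> t * (I t - \<delta> t))"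
    by metis
  have "\<forall>t s. \<exists>r. t \<in> {1..T} \<and> s \<in> {1..S} \<longrightarrow> 0 < r \<and> r \<le> 1 \<and>
      info_moment UNIV UNIV (p t) (V s) r \<le> 2 powr (r * (mutual_info (p t) (V s) + \<delta> t))"
    using info_moment_bounds(1)[OF \<delta>] by blast
  then obtain \<rho> where \<rho>: "\<And>t s. t \<in> {1..T} \<Longrightarrow> s \<in> {1..S} \<Longrightarrow> 0 < \<rho> t s"
      "\<And>t s. t \<in> {1..T} \<Longrightarrow> s \<in> {1..S} \<Longrightarrow> \<rho> t s \<le> 1"
      "\<And>t s. t \<in> {1..T} \<Longrightarrow> s \<in> {1..S} \<Longrightarrow>
        info_moment UNIV UNIV (p t) (V s) (\<rho> t s) \<le> 2 powr (\<rho> t s * (mutual_info (p t) (V s) + \<delta> t))"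
    by metis
  \<comment> \<open>The outer 2 comes from expurgation. The 8 is a product of three doublings: twice
    as many messages before expurgation, and the rounding of \<open>J\<close> and of
    \<open>L t\<close>.\<close>
  define e where "e n = 2 * (\<Sum>t\<in>{1..T}. (2 powr (- (\<sigma> t * \<delta> t))) ^ n +
      (\<Sum>t'\<in>{1..T}. 8 * (2 powr (- \<delta> t')) ^ n) +
      (\<Sum>s\<in>{1..S}. 2 / (\<rho> t s * ln 2) * (2 powr (- (\<rho> t s * \<delta> t))) ^ n))" for n
  have pow0: "(\<lambda>n. (2 powr (- a)) ^ n) \<longlonglongrightarrow> 0" if "0 < a" for a :: real
    using that by (intro LIMSEQ_power_zero) (simp add: powr_less_one)
  have "e \<longlonglongrightarrow> 2 * (\<Sum>t\<in>{1..T}. 0 + (\<Sum>t'\<in>{1..T}. 8 * 0) + (\<Sum>s\<in>{1..S}. 2 / (\<rho> t s * ln 2) * 0))"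
    unfolding e_def using \<delta> \<sigma>(1) \<rho>(1)
    by (intro tendsto_mult tendsto_const tendsto_sum tendsto_add pow0) (auto intro!: mult_pos_pos)
  then have e: "e \<longlonglongrightarrow> 0"
    by simp
  show ?thesis
  proof (rule achievable_CSI_tI[OF T S R e])
    fix n
    define J where "J = nat \<lceil>2 powr (real n * R)\<rceil>"
    define L where "L t = nat \<lceil>2 powr (real n * (v t + 2 * \<delta> t))\<rceil>" for t
    define \<theta> where "\<theta> t = 2 powr (real n * (I t - 2 * \<delta> t))" for t
    have J: "2 powr (real n * R) \<le> real J" "real J \<le> 2 * 2 powr (real n * R)" "1 \<le> J"
      using nat_ceiling_le_double[of "2 powr (real n * R)"] R by (auto simp: J_def ge_one_powr_ge_zero)
    have L_bounds: "2 powr (real n * (v t + 2 * \<delta> t)) \<le> real (L t)"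
        "real (L t) \<le> 2 * 2 powr (real n * (v t + 2 * \<delta> t))" "1 \<le> L t" if "t \<in> {1..T}" for t
      using nat_ceiling_le_double[of "2 powr (real n * (v t + 2 * \<delta> t))"] v(2)[OF that] \<delta>[OF that]
      by (auto simp: L_def ge_one_powr_ge_zero)
    interpret random_code T S "2 * J" L \<theta> "words n" "words n" "words n" "\<lambda>t. iid n (p t)"
      "\<lambda>t. memoryless_ext (W t)" "\<lambda>s. memoryless_ext (V s)"
    proof
      show "set_pmf (iid n (p t)) \<subseteq> words n" for t
        unfolding set_pmf_iid by blast
    qed (simp_all add: set_pmf_memoryless_ext_words L_bounds(3)[unfolded One_nat_def] \<theta>_def)
    have miss: "miss_prob t \<le> (2 powr (- (\<sigma> t * \<delta> t))) ^ n" if t: "t \<in> {1..T}" for t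
    proof -
      have "miss_prob t \<le> \<theta> t powr \<sigma> t * info_moment UNIV UNIV (p t) (W t) (- \<sigma> t) ^ n"
        unfolding miss_prob_def
        using threshold_miss_bound[of "words n" "words n" "iid n (p t)" "\<sigma> t" "\<theta> t" "memoryless_ext (W t)"]
          \<sigma>(1)[OF t] by (simp add: info_moment_memoryless_ext set_pmf_iid \<theta>_def)
      also have "\<dots> \<le> \<theta> t powr \<sigma> t * (2 powr (- \<sigma> t * (I t - \<delta> t))) ^ n"
        by (intro mult_left_mono power_mono \<sigma>(2)[OF t]) (auto simp: info_moment_nonneg)
      also have "\<dots> = 2 powr (real n * (I t - 2 * \<delta> t) * \<sigma> t + real n * (- \<sigma> t * (I t - \<delta> t)))"
        unfolding powr_mult_nat[symmetric] \<theta>_def powr_powr powr_add by simp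
      also have "\<dots> = 2 powr (real n * (- (\<sigma> t * \<delta> t)))"
        by (simp add: algebra_simps)
      finally show ?thesis
        unfolding powr_mult_nat .
    qed
    have conf: "confusion \<le> (\<Sum>t'\<in>{1..T}. 8 * (2 powr (- \<delta> t')) ^ n)"
      unfolding confusion_def
    proof (rule sum_mono)
      fix t assume t: "t \<in> {1..T}"
      have "real (2 * J) * real (L t) / \<theta> t \<le>
          (2 * (2 * 2 powr (real n * R))) * (2 * 2 powr (real n * (v t + 2 * \<delta> t))) / \<theta> t"
        using J(2) by (intro divide_right_mono mult_mono L_bounds(2)[OF t]) (auto simp: \<theta>_def)
      also have "\<dots> = 8 * 2 powr (real n * R + real n * (v t + 2 * \<delta> t) - real n * (I t - 2 * \<delta> t))"
        by (simp add: \<theta>_def powr_add powr_diff)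
      also have "real n * R + real n * (v t + 2 * \<delta> t) - real n * (I t - 2 * \<delta> t) = real n * (- \<delta> t)"
      proof -
        have "I t = R + v t + 5 * \<delta> t"
          by (simp add: \<delta>_def field_simps)
        then show ?thesis
          by (simp add: algebra_simps)
      qed
      finally show "real (2 * J) * real (L t) / \<theta> t \<le> 8 * (2 powr (- \<delta> t)) ^ n"
        unfolding powr_mult_nat .
    qed
    have res: "resolution t s \<le> 2 / (\<rho> t s * ln 2) * (2 powr (- (\<rho> t s * \<delta> t))) ^ n"
      if t: "t \<in> {1..T}" and s: "s \<in> {1..S}" for t s
    proof -
      let ?r = "\<rho> t s"
      have Lpos: "0 < real (L t)"
        using L_bounds(3)[OF t] by simp
      have "resolution t s \<le> 2 / (?r * ln 2) * real (L t) powr (- ?r) * info_moment UNIV UNIV (p t) (V s) ?r ^ n"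
        unfolding resolution_def info_moment_memoryless_ext[symmetric]
        by (rule resolvability_moment_bound[OF \<rho>(1,2)[OF t s] Lpos])
      also have "\<dots> \<le> 2 / (?r * ln 2) * (2 powr (real n * (v t + 2 * \<delta> t))) powr (- ?r) * (2 powr (?r * (v t + \<delta> t))) ^ n"
      proof (intro mult_mono power_mono)
        show "real (L t) powr (- ?r) \<le> (2 powr (real n * (v t + 2 * \<delta> t))) powr (- ?r)"
          using L_bounds(1)[OF t] \<rho>(1)[OF t s] by (intro powr_mono2') auto
        have "info_moment UNIV UNIV (p t) (V s) ?r \<le> 2 powr (?r * (mutual_info (p t) (V s) + \<delta> t))"
          by (rule \<rho>(3)[OF t s])
        also have "\<dots> \<le> 2 powr (?r * (v t + \<delta> t))"
          using v(1)[OF t s] \<rho>(1)[OF t s] by (intro powr_mono mult_left_mono) auto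
        finally show "info_moment UNIV UNIV (p t) (V s) ?r \<le> 2 powr (?r * (v t + \<delta> t))" .
      qed (use \<rho>(1)[OF t s] in \<open>auto simp: info_moment_nonneg\<close>)
      also have "\<dots> = 2 / (?r * ln 2) * 2 powr (real n * (v t + 2 * \<delta> t) * (- ?r) + real n * (?r * (v t + \<delta> t)))"
        unfolding powr_mult_nat[symmetric] powr_powr powr_add by simp
      also have "real n * (v t + 2 * \<delta> t) * (- ?r) + real n * (?r * (v t + \<delta> t)) = real n * (- (?r * \<delta> t))"
        by (simp add: algebra_simps)
      finally show ?thesis
        unfolding powr_mult_nat .
    qed
    have eps: "2 * mean_cost \<le> e n"
      unfolding mean_cost_def e_def by (intro mult_left_mono sum_mono add_mono miss conf res) auto
    from exists_good_code[OF refl] obtain E D where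
      "\<forall>t\<in>{1..T}. \<forall>j\<in>{1..J}. set_pmf (E t j) \<subseteq> set_pmf (iid n (p t))"
      "\<forall>j\<in>{1..J}. D j \<subseteq> words n" "disjoint_family_on D {1..J}"
      "\<forall>t\<in>{1..T}. \<forall>j\<in>{1..J}. measure_pmf.expectation (E t j)
          (\<lambda>x. measure_pmf.prob (memoryless_ext (W t) x) (words n - D j)) \<le> 2 * mean_cost"
      "\<forall>t\<in>{1..T}. \<forall>s\<in>{1..S}. \<forall>j\<in>{1..J}. divergence (words n)
          (bind_pmf (E t j) (memoryless_ext (V s))) (bind_pmf (iid n (p t)) (memoryless_ext (V s))) \<le> 2 * mean_cost"
      by (elim exE conjE) (rule that)
    note ED = this[rule_format]
    have words: "set_pmf (E t j) \<subseteq> words n" if "t \<in> {1..T}" "j \<in> {1..J}" for t j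
      using ED(1)[OF that] unfolding set_pmf_iid by blast
    show "\<exists>J E D. 2 powr (real n * R) \<le> real J \<and> is_code T n J E D \<and>
      (\<forall>t\<in>{1..T}. \<forall>j\<in>{1..J}. (\<Sum>xs\<in>words n. pmf (E t j) xs *
          measure_pmf.prob (memoryless_ext (W t) xs) (words n - D j)) \<le> e n) \<and>
      (\<forall>t\<in>{1..T}. \<forall>s\<in>{1..S}. \<forall>j\<in>{1..J}. divergence (words n)
          (bind_pmf (E t j) (memoryless_ext (V s))) (bind_pmf (iid n (p t)) (memoryless_ext (V s))) \<le> e n \<and>
          set_pmf (bind_pmf (E t j) (memoryless_ext (V s))) \<subseteq>
            set_pmf (bind_pmf (iid n (p t)) (memoryless_ext (V s))))"
    proof (intro exI[of _ J] exI[of _ E] exI[of _ D] conjI ballI)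
      show "is_code T n J E D"
        using J(3) words ED(2,3) by (simp add: is_code_def)
      show "(\<Sum>xs\<in>words n. pmf (E t j) xs *
          measure_pmf.prob (memoryless_ext (W t) xs) (words n - D j)) \<le> e n"
        if "t \<in> {1..T}" "j \<in> {1..J}" for t j
        using ED(4)[OF that] eps expectation_finite[OF finite_words words[OF that]] by simp
      show "divergence (words n) (bind_pmf (E t j) (memoryless_ext (V s)))
          (bind_pmf (iid n (p t)) (memoryless_ext (V s))) \<le> e n"
        if "t \<in> {1..T}" "s \<in> {1..S}" "j \<in> {1..J}" for t s j
        using ED(5)[OF that] eps by simp
      show "set_pmf (bind_pmf (E t j) (memoryless_ext (V s))) \<subseteq>
          set_pmf (bind_pmf (iid n (p t)) (memoryless_ext (V s)))"
        if "t \<in> {1..T}" "j \<in> {1..J}" for t s j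
        using ED(1)[OF that] unfolding set_bind_pmf by blast
    qed (rule J(1))
  qed
qed

text \<open>The averaged input varies with \<open>n\<close>, and so may the eavesdropper that is
  worst for it. Neither matters: \<open>M\<close> bounds the gap for every input, and the leakage is
  already a maximum over \<open>s\<close>.\<close>

lemma achievable_le:
  fixes W :: "nat \<Rightarrow> 'a::finite \<Rightarrow> 'b::finite pmf" and V :: "nat \<Rightarrow> 'a \<Rightarrow> 'c::finite pmf"
  assumes t: "t \<in> {1..T}" and S: "1 \<le> S" and deg: "\<And>s. s \<in> {1..S} \<Longrightarrow> degraded (W t) (V s)"
    and M: "\<And>p. mutual_info p (W t) - (MAX s\<in>{1..S}. mutual_info p (V s)) \<le> M"
    and ach: "achievable_CSI_t T S W V R"
  shows "R \<le> M"
proof -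
  obtain J E D where code: "\<And>n. is_code T n (J n) (E n) (D n)"
    and err: "(\<lambda>n. max_error T W n (J n) (E n) (D n)) \<longlonglongrightarrow> 0"
    and rate: "ereal R \<le> liminf (\<lambda>n. ereal (1 / real n * log 2 (real (J n))))"
    and leak: "(\<lambda>n. max_leakage T S V (J n) (E n)) \<longlonglongrightarrow> 0"
    using ach unfolding achievable_CSI_t_def by blast
  define \<epsilon> where "\<epsilon> n = max_error T W n (J n) (E n) (D n)" for n
  define l where "l n = max_leakage T S V (J n) (E n)" for n
  \<comment> \<open>The finite-length bound solved for the rate; the numerator tends to
    \<open>M\<close>, the denominator to 1.\<close>
  define b where "b n = (M + (1 + l n) * (1 / real n)) / (1 - \<epsilon> n)" for n
  have bound: "(1 - \<epsilon> n) * log 2 (real (J n)) - 1 - l n \<le> real n * M" if n: "0 < n" for n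
  proof -
    let ?p = "mean_letter n (bind_pmf (pmf_of_set {1..J n}) (E n t))"
    have "(MAX s\<in>{1..S}. mutual_info ?p (V s)) \<in> (\<lambda>s. mutual_info ?p (V s)) ` {1..S}"
      using S by (intro Max_in) auto
    then obtain s where s: "s \<in> {1..S}" "(MAX s\<in>{1..S}. mutual_info ?p (V s)) = mutual_info ?p (V s)"
      by blast
    have "(1 - \<epsilon> n) * log 2 (real (J n)) - 1
        - mutual_info (pmf_of_set {1..J n}) (\<lambda>j. bind_pmf (E n t j) (memoryless_ext (V s)))
      \<le> real n * (mutual_info ?p (W t) - mutual_info ?p (V s))"
    proof (rule converse_block[OF _ n deg[OF s(1)]])
      show "1 \<le> J n" "disjoint_family_on (D n) {1..J n}"
        using code[of n] by (auto simp: is_code_def)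
      show "set_pmf (E n t j) \<subseteq> words n" if "j \<in> {1..J n}" for j
        using code[of n] t that by (auto simp: is_code_def)
      show "(\<Sum>xs\<in>words n. pmf (E n t j) xs *
          measure_pmf.prob (memoryless_ext (W t) xs) (words n - D n j)) \<le> \<epsilon> n" (is "?f t j \<le> _")
        if j: "j \<in> {1..J n}" for j
      proof -
        have "?f t j \<le> (MAX j\<in>{1..J n}. ?f t j)"
          using j by (intro Max_ge) auto
        also have "\<dots> \<le> \<epsilon> n"
          unfolding \<epsilon>_def max_error_def using t by (intro Max_ge) auto
        finally show ?thesis .
      qed
    qed
    moreover have "mutual_info (pmf_of_set {1..J n}) (\<lambda>j. bind_pmf (E n t j) (memoryless_ext (V s))) \<le> l n"
      unfolding l_def max_leakage_def using t s(1) by (intro Max_ge) auto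
    moreover have "real n * (mutual_info ?p (W t) - mutual_info ?p (V s)) \<le> real n * M"
      using M[of ?p] s(2) by (intro mult_left_mono) auto
    ultimately show ?thesis
      by linarith
  qed
  have "b \<longlonglongrightarrow> (M + (1 + 0) * 0) / (1 - 0)"
    unfolding b_def using err leak lim_1_over_n
    by (intro tendsto_intros) (auto simp: \<epsilon>_def l_def)
  then have lim_b: "(\<lambda>n. ereal (b n)) \<longlonglongrightarrow> ereal M"
    by simp
  have "\<forall>\<^sub>F n in sequentially. \<epsilon> n < 1"
    using err unfolding \<epsilon>_def by (rule order_tendstoD) simp
  then have "\<forall>\<^sub>F n in sequentially. ereal (1 / real n * log 2 (real (J n))) \<le> ereal (b n)"
    using eventually_gt_at_top[of "0::nat"]
  proof eventually_elim
    case (elim n)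
    have "(1 - \<epsilon> n) * log 2 (real (J n)) \<le> real n * M + (1 + l n)"
      using bound[of n] elim by linarith
    then have "log 2 (real (J n)) \<le> (real n * M + (1 + l n)) / (1 - \<epsilon> n)"
      using elim by (simp add: pos_le_divide_eq mult.commute)
    then have "1 / real n * log 2 (real (J n)) \<le> 1 / real n * ((real n * M + (1 + l n)) / (1 - \<epsilon> n))"
      by (intro mult_left_mono) auto
    also have "1 / real n * (real n * M + (1 + l n)) = M + (1 + l n) * (1 / real n)"
      using elim by (simp add: distrib_left add_divide_distrib)
    then have "1 / real n * ((real n * M + (1 + l n)) / (1 - \<epsilon> n)) = b n"
      unfolding b_def by (metis times_divide_eq_right)
    finally show ?case
      by simp
  qed
  then have "liminf (\<lambda>n. ereal (1 / real n * log 2 (real (J n)))) \<le> liminf (\<lambda>n. ereal (b n))"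
    by (rule Liminf_mono)
  also have "\<dots> = ereal M"
    using lim_b by (intro lim_imp_Liminf) auto
  finally have "ereal R \<le> ereal M"
    using rate by (rule order_trans[rotated])
  then show ?thesis
    by simp
qed

section \<open>Optimal inputs and the capacity\<close>

text \<open>Only the point 0 needs care. There \<open>ln y \<le> y\<close> at
  \<open>y = 1 / sqrt x\<close> gives the majorant \<open>2 * sqrt x\<close>.\<close>

lemma continuous_on_xlog: "continuous_on {0..} (\<lambda>x::real. x * log 2 x)"
proof -
  have "((\<lambda>x::real. x * ln x) \<longlongrightarrow> 0) (at 0 within {0..})"
  proof (rule Lim_null_comparison)
    have "norm (x * ln x) \<le> 2 * sqrt x" if "0 \<le> x" "x < 1" for x :: real
    proof (cases "x = 0")
      case False
      have "ln (1 / sqrt x) \<le> 1 / sqrt x"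
        using that False by (intro ln_bound) auto
      then have "- ln x \<le> 2 / sqrt x"
        using that False by (simp add: ln_div ln_sqrt)
      then have "x * - ln x \<le> x * (2 / sqrt x)"
        using that by (intro mult_left_mono) auto
      also have "\<dots> = 2 * (x / sqrt x)"
        by simp
      also have "\<dots> = 2 * sqrt x"
        by (simp only: real_div_sqrt[OF that(1)])
      finally show ?thesis
        using that False by (simp add: abs_mult)
    qed simp
    then show "\<forall>\<^sub>F x in at 0 within {0..}. norm (x * ln x) \<le> 2 * sqrt x"
      unfolding eventually_at by (intro exI[of _ 1]) (auto simp: dist_real_def)
    have "((\<lambda>x. 2 * sqrt x) \<longlongrightarrow> 2 * sqrt 0) (at 0 within {0..})"
      by (intro tendsto_intros)
    then show "((\<lambda>x. 2 * sqrt x) \<longlongrightarrow> 0) (at 0 within {0..})"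
      by simp
  qed
  then have "continuous (at x within {0..}) (\<lambda>x. x * ln x)" if "0 \<le> x" for x :: real
    using that by (cases "x = 0") (auto simp: continuous_within intro!: tendsto_intros)
  then have "continuous_on {0..} (\<lambda>x::real. x * ln x / ln 2)"
    by (intro continuous_on_divide continuous_on_const) (auto simp: continuous_on_eq_continuous_within)
  then show ?thesis
    by (simp add: log_def)
qed

lemma continuous_on_Max_image:
  fixes f :: "'i \<Rightarrow> 'a::topological_space \<Rightarrow> 'b::linorder_topology"
  assumes "finite I" "I \<noteq> {}" "\<And>i. i \<in> I \<Longrightarrow> continuous_on K (f i)"
  shows "continuous_on K (\<lambda>x. MAX i\<in>I. f i x)"
  using assms
proof (induction I rule: finite_ne_induct)
  case (insert i I)
  have "(MAX j\<in>insert i I. f j x) = max (f i x) (MAX j\<in>I. f j x)" for x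
    using insert by simp
  then show ?case
    using insert by (auto intro!: continuous_on_max)
qed simp

text \<open>Input distributions as vectors of a Euclidean space, where compactness and continuity
  are available.\<close>

definition prob_simplex :: "(real ^ 'a::finite) set" where
  "prob_simplex = {v. (\<forall>i. 0 \<le> v $ i) \<and> (\<Sum>i\<in>UNIV. v $ i) = 1}"

lemma compact_prob_simplex: "compact prob_simplex"
  unfolding compact_eq_bounded_closed
proof
  have "norm v \<le> 1" if "v \<in> prob_simplex" for v :: "real ^ 'a"
    using norm_le_l1_cart[of v] that by (simp add: prob_simplex_def)
  then show "bounded (prob_simplex :: (real ^ 'a) set)"
    by (auto simp: bounded_iff)
  show "closed (prob_simplex :: (real ^ 'a) set)"
    unfolding prob_simplex_def
    by (intro closed_Collect_conj closed_Collect_all closed_Collect_le closed_Collect_eq continuous_intros)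
qed

lemma pmf_in_prob_simplex: "(\<chi> i. pmf p i) \<in> prob_simplex"
  by (simp add: prob_simplex_def sum_pmf_eq_1)

lemma prob_simplex_obtain_pmf:
  assumes "v \<in> prob_simplex"
  obtains p :: "'a::finite pmf" where "v = (\<chi> i. pmf p i)"
proof
  have "(\<integral>\<^sup>+ x. ennreal (v $ x) \<partial>count_space UNIV) = 1"
    using assms by (simp add: nn_integral_count_space_finite prob_simplex_def sum_ennreal)
  then have "pmf (embed_pmf (($) v)) i = v $ i" for i
    using assms by (intro pmf_embed_pmf) (auto simp: prob_simplex_def)
  then show "v = (\<chi> i. pmf (embed_pmf (($) v)) i)"
    by (simp add: vec_eq_iff)
qed

text \<open>Output entropy minus conditional entropy, with the signs carried by the logarithms.
  Unlike a sum of logarithms of ratios, it uses only linear functions of \<open>v\<close> and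
  \<open>x * log 2 x\<close> applied to them, hence is continuous up to the boundary of the
  simplex.\<close>

definition vec_mutual_info :: "real ^ 'a \<Rightarrow> ('a::finite \<Rightarrow> 'b::finite pmf) \<Rightarrow> real" where
  "vec_mutual_info v W =
    (\<Sum>x\<in>UNIV. \<Sum>y\<in>UNIV. v $ x * (pmf (W x) y * log 2 (pmf (W x) y))) -
    (\<Sum>y\<in>UNIV. (\<Sum>x\<in>UNIV. v $ x * pmf (W x) y) * log 2 (\<Sum>x\<in>UNIV. v $ x * pmf (W x) y))"

lemma vec_mutual_info_pmf: "vec_mutual_info (\<chi> i. pmf p i) W = mutual_info p W"
proof -
  let ?q = "bind_pmf p W"
  have q: "pmf ?q y = (\<Sum>x\<in>UNIV. pmf p x * pmf (W x) y)" for y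
    by (rule pmf_bind_finite) auto
  have "pmf p x * pmf (W x) y * log 2 (pmf (W x) y / pmf ?q y) =
      pmf p x * (pmf (W x) y * log 2 (pmf (W x) y)) - pmf p x * pmf (W x) y * log 2 (pmf ?q y)" for x y
  proof (cases "pmf p x * pmf (W x) y = 0")
    case False
    then have "x \<in> set_pmf p" "y \<in> set_pmf (W x)"
      by (auto simp: set_pmf_iff)
    then have "0 < pmf (W x) y" "0 < pmf ?q y"
      by (auto simp: pmf_positive_iff)
    then show ?thesis
      by (simp add: log_divide algebra_simps)
  qed auto
  then have "mutual_info p W = (\<Sum>x\<in>UNIV. \<Sum>y\<in>UNIV. pmf p x * (pmf (W x) y * log 2 (pmf (W x) y))) -
      (\<Sum>x\<in>UNIV. \<Sum>y\<in>UNIV. pmf p x * pmf (W x) y * log 2 (pmf ?q y))"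
    by (subst mutual_info_eq[of UNIV p UNIV]) (simp_all add: sum_subtractf)
  also have "(\<Sum>x\<in>UNIV. \<Sum>y\<in>UNIV. pmf p x * pmf (W x) y * log 2 (pmf ?q y)) =
      (\<Sum>y\<in>UNIV. pmf ?q y * log 2 (pmf ?q y))"
    by (subst sum.swap) (simp add: q sum_distrib_right)
  finally show ?thesis
    by (simp add: vec_mutual_info_def q)
qed

lemma continuous_on_vec_mutual_info: "continuous_on prob_simplex (\<lambda>v. vec_mutual_info v W)"
proof -
  have "continuous_on prob_simplex
      (\<lambda>v. (\<Sum>x\<in>UNIV. v $ x * pmf (W x) y) * log 2 (\<Sum>x\<in>UNIV. v $ x * pmf (W x) y))" for y
  proof (rule continuous_on_compose2[OF continuous_on_xlog])
    show "continuous_on prob_simplex (\<lambda>v. \<Sum>x\<in>UNIV. v $ x * pmf (W x) y)"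
      by (intro continuous_intros)
    show "(\<lambda>v. \<Sum>x\<in>UNIV. v $ x * pmf (W x) y) ` prob_simplex \<subseteq> {0..}"
      by (auto simp: prob_simplex_def intro!: sum_nonneg)
  qed
  then show ?thesis
    unfolding vec_mutual_info_def
    by (intro continuous_on_diff[OF _ continuous_on_sum]) (intro continuous_intros)
qed

lemma exists_optimal_input:
  fixes W :: "'a::finite \<Rightarrow> 'b::finite pmf" and V :: "nat \<Rightarrow> 'a \<Rightarrow> 'c::finite pmf"
  assumes "1 \<le> S"
  obtains p where "\<And>p'. mutual_info p' W - (MAX s\<in>{1..S}. mutual_info p' (V s)) \<le>
    mutual_info p W - (MAX s\<in>{1..S}. mutual_info p (V s))"
proof -
  let ?f = "\<lambda>v. vec_mutual_info v W - (MAX s\<in>{1..S}. vec_mutual_info v (V s))"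
  have "continuous_on prob_simplex ?f"
    using assms by (intro continuous_on_diff continuous_on_vec_mutual_info continuous_on_Max_image) auto
  moreover have "prob_simplex \<noteq> ({} :: (real ^ 'a) set)"
    using pmf_in_prob_simplex by blast
  ultimately obtain v where v: "v \<in> prob_simplex" "\<And>v'. v' \<in> prob_simplex \<Longrightarrow> ?f v' \<le> ?f v"
    using continuous_attains_sup[OF compact_prob_simplex] by blast
  obtain p where "v = (\<chi> i. pmf p i)"
    using prob_simplex_obtain_pmf[OF v(1)] .
  then show ?thesis
    using v(2)[OF pmf_in_prob_simplex] that[of p] by (simp add: vec_mutual_info_pmf)
qed

text \<open>The first conjunct states that the optimum over inputs is attained, so the real-valued
  \<open>SUP\<close> in the second is a genuine maximum and not the default value of an unbounded
  supremum.\<close>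

theorem proposition3p13:
  fixes T S :: nat
    and W :: "nat \<Rightarrow> 'a::finite \<Rightarrow> 'b::finite pmf"
    and V :: "nat \<Rightarrow> 'a \<Rightarrow> 'c::finite pmf"
  assumes "1 \<le> T" and "1 \<le> S"
    and "\<forall>t\<in>{1..T}. \<forall>s\<in>{1..S}. degraded (W t) (V s)"
  shows "(\<forall>t\<in>{1..T}. \<exists>p. is_arg_max
            (\<lambda>p. mutual_info p (W t) - (MAX s\<in>{1..S}. mutual_info p (V s))) (\<lambda>_. True) p) \<and>
         secrecy_capacity_CSI_t T S W V =
           ereal (MIN t\<in>{1..T}. SUP p.
             mutual_info p (W t) - (MAX s\<in>{1..S}. mutual_info p (V s)))"
proof
  define f where "f t p = mutual_info p (W t) - (MAX s\<in>{1..S}. mutual_info p (V s))" for t p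
  have "\<forall>t. \<exists>p. \<forall>p'. f t p' \<le> f t p"
    unfolding f_def using exists_optimal_input[OF assms(2)] by metis
  then obtain p where p: "\<And>t p'. f t p' \<le> f t (p t)"
    by metis
  show "\<forall>t\<in>{1..T}. \<exists>p. is_arg_max
      (\<lambda>p. mutual_info p (W t) - (MAX s\<in>{1..S}. mutual_info p (V s))) (\<lambda>_. True) p"
    using p unfolding f_def[symmetric] is_arg_max_def by (metis not_le)
  have sup: "(SUP p. f t p) = f t (p t)" for t
    using p by (intro cSup_eq_maximum) auto
  define M where "M = (MIN t\<in>{1..T}. f t (p t))"
  have M_le: "M \<le> f t (p t)" if "t \<in> {1..T}" for t
    unfolding M_def using that by (intro Min_le) auto
  have "M \<in> (\<lambda>t. f t (p t)) ` {1..T}"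
    unfolding M_def using assms(1) by (intro Min_in) auto
  then obtain t0 where t0: "t0 \<in> {1..T}" "M = f t0 (p t0)"
    by blast
  have upper: "R \<le> M" if "achievable_CSI_t T S W V R" for R
    using p[of t0] assms(3) t0 that unfolding f_def
    by (intro achievable_le[OF t0(1) assms(2) _ _ that]) auto
  have zero: "achievable_CSI_t T S W V 0"
    by (rule achievable_0[OF assms(1,2)])
  have lower: "achievable_CSI_t T S W V R" if R: "0 \<le> R" "R < M" for R
  proof (rule achievable_below[OF assms(1,2) R(1), where p = p and v = "\<lambda>t. MAX s\<in>{1..S}. mutual_info (p t) (V s)"])
    show mx: "mutual_info (p t) (V s) \<le> (MAX s\<in>{1..S}. mutual_info (p t) (V s))" if "s \<in> {1..S}" for t s
      using that by (intro Max_ge) auto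
    show "0 \<le> (MAX s\<in>{1..S}. mutual_info (p t) (V s))" for t
    proof -
      have "0 \<le> mutual_info (p t) (V 1)"
        by (rule mutual_info_nonneg[of UNIV _ UNIV]) auto
      then show ?thesis
        using mx[of 1 t] assms(2) by (meson atLeastAtMost_iff order_refl order_trans)
    qed
    show "R + (MAX s\<in>{1..S}. mutual_info (p t) (V s)) < mutual_info (p t) (W t)" if "t \<in> {1..T}" for t
      using M_le[OF that] R(2) unfolding f_def by linarith
  qed
  have "secrecy_capacity_CSI_t T S W V = ereal M"
  proof (rule antisym)
    show "secrecy_capacity_CSI_t T S W V \<le> ereal M"
      unfolding secrecy_capacity_CSI_t_def using upper by (intro SUP_least) auto
    show "ereal M \<le> secrecy_capacity_CSI_t T S W V"
    \<comment> \<open>Only rates below \<open>M\<close> are known to be achievable, so a real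
      \<open>r\<close> is placed strictly between the capacity and \<open>M\<close>. Achievability
      of rate 0 forces \<open>0 < r\<close>, and then \<open>r\<close> itself is achievable, a
      contradiction.\<close>
    proof (rule ccontr)
      assume "\<not> ?thesis"
      then obtain r where r: "secrecy_capacity_CSI_t T S W V < ereal r" "r < M"
        by (metis ereal_dense2 ereal_less_eq(3) less_ereal.simps(1) not_le)
      have ge: "ereal R \<le> secrecy_capacity_CSI_t T S W V" if "achievable_CSI_t T S W V R" for R
        unfolding secrecy_capacity_CSI_t_def using that by (intro SUP_upper) auto
      have "0 < r"
        using ge[OF zero] r(1) by (metis ereal_less(2) le_less_trans zero_ereal_def)
      then show False
        using ge[OF lower] r by (meson less_imp_le not_le)
    qed
  qed
  then show "secrecy_capacity_CSI_t T S W V =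
      ereal (MIN t\<in>{1..T}. SUP p. mutual_info p (W t) - (MAX s\<in>{1..S}. mutual_info p (V s)))"
    unfolding f_def[symmetric] sup M_def .
qed

end
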